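(* Let $x^*\in\mathbb{R}^n$ be a local minimizer of the problem (SOCP), and suppose that at least one of the following holds: (a) for every sequence $\rho_k\to+\infty$ and every sequence $x^k\to x^*$ such that each $x^k$ is a local minimizer of the penalty function $F_k$, setting $\omega_i^k:=\rho_k\Pi_{\mathcal{K}_i}(-g_i(x^k))$, the sequence $\{[\omega_i^k]_0\}_{k\in\tilde N_i}$ is bounded for every $i\in I_B(x^* )$, where $\tilde N_i:=\{k\mid g_i(x^k)\in\mathbb{R}^{m_i}\setminus(\mathcal{K}_i\cup-\mathcal{K}_i)\}$; or (b) the feasibility measure $Q(x):=\frac12\|h(x)\|^2+\frac12\|\Pi_{\mathcal{K}}(-g(x))\|^2$ satisfies the generalized Lojasiewicz inequality at $x^*$. Then $x^*$ satisfies the CAKKT2 conditions.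
   Context: Problem (SOCP): minimize $f(x)$ over $x\in\mathbb{R}^n$ subject to $g_i(x)\in\mathcal{K}_i$ ($i=1,\dots,r$) and $h(x)=0$, where $f:\mathbb{R}^n\to\mathbb{R}$, $h:\mathbb{R}^n\to\mathbb{R}^p$, $g_i:\mathbb{R}^n\to\mathbb{R}^{m_i}$ are twice continuously differentiable. A vector $w\in\mathbb{R}^\ell$ is written $w=(w_0,\overline{w})\in\mathbb{R}\times\mathbb{R}^{\ell-1}$, and $[w]_0:=w_0$. $\mathcal{K}_i:=\{(w_0,\overline w)\in\mathbb{R}\times\mathbb{R}^{m_i-1}\mid w_0\ge\|\overline w\|\}$ if $m_i>1$ and $\mathcal{K}_i:=\{w\in\mathbb{R}\mid w\ge0\}$ if $m_i=1$; $\mathcal{K}:=\mathcal{K}_1\times\dots\times\mathcal{K}_r$, $g:=(g_1,\dots,g_r)$. $\|\cdot\|$ is the Euclidean norm, $\Pi_C$ is the Euclidean projection onto $C$, $D$ denotes the Jacobian (rows are transposed gradients). $\mathrm{bd}^+(\mathcal{K}_i)$ is the set where $w_0=\|\overline w\|\ne0$. For feasible $x$: $I_0(x):=\{i\mid g_i(x)=0\}$, $I_B(x):=\{i\mid g_i(x)\in\mathrm{bd}^+(\mathcal{K}_i)\}$. Lagrangian: $L(x,\mu,\omega):=f(x)+\langle h(x),\mu\rangle-\langle g(x),\omega\rangle$ for $\mu\in\mathbb{R}^p$, $\omega=(\omega_1,\dots,\omega_r)\in\mathcal{K}$; $\nabla_x L,\nabla_x^2L$ are its gradient and Hessian in $x$.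 Penalty function: $F_k(x):=f(x)+\frac14\|x-x^*\|^4+\frac{\rho_k}{2}\left(\sum_{i=1}^r\|\Pi_{\mathcal{K}_i}(-g_i(x))\|^2+\|h(x)\|^2\right)$. Generalized Lojasiewicz inequality for a differentiable function $Q$ at $x^*$: there exist $\delta>0$ and $\vartheta:B(x^*,\delta)\to\mathbb{R}$ ($B(x^*,\delta)$ the Euclidean ball) with $\lim_{x\to x^*}\vartheta(x)=0$ and $|Q(x)-Q(x^* )|\le\vartheta(x)\|\nabla Q(x)\|$ for $x\in B(x^*,\delta)$. $\Gamma_i:=\begin{pmatrix}1&0^\top\\0&-I_{m_i-1}\end{pmatrix}$, $\tilde g_i(x):=(\|\overline{g_i(x)}\|,\overline{g_i(x)})$, and, relative to $x^*$, $\sigma(x,\omega):=\sum_{i\in I_B(x^* )}-\frac{[\omega_i]_0}{[g_i(x)]_0}Dg_i(x)^\top\Gamma_iDg_i(x)$. Jordan product: $y\circ z:=(\langle y,z\rangle,\,y_0\overline z+z_0\overline y)$. CAKKT conditions: sequences $x^k\to x^*$, $\{\mu^k\}\subset\mathbb{R}^p$, $\{\omega^k\}\subset\mathcal{K}$ satisfy the CAKKT conditions at a feasible $x^*$ if $\nabla_xL(x^k,\mu^k,\omega^k)\to0$, $g_i(x^k)\circ\omega_i^k\to0$ for $i=1,\dots,r$, and $h_i(x^k)\mu_i^k\to0$ for $i=1,\dots,p$. CAKKT2 conditions: a feasible point $x^*$ satisfies CAKKT2 if there exist sequences $x^k\to x^*$, $\{\mu^k\}\subset\mathbb{R}^p$,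 $\{\omega^k\}\subset\mathcal{K}$ satisfying the CAKKT conditions and, in addition, sequences $\{\eta^k\}\subset\mathbb{R}^p$, $\{\theta_i^k\}\subset\mathbb{R}$ ($i\in I_0(x^* )$), $\{\gamma_i^k\}\subset\mathbb{R}$ ($i\in I_B(x^* )$), $\{\delta_k\}\subset\mathbb{R}_+$ with $\delta_k\to0$, such that for all sufficiently large $k$ and all $d\in\mathbb{R}^n$, $$d^\top\Big(\nabla_x^2L(x^k,\mu^k,\omega^k)+\sigma(x^k,\omega^k)+\sum_{i=1}^p\eta_i^k\nabla h_i(x^k)\nabla h_i(x^k)^\top+\sum_{i\in I_B(x^* )}\gamma_i^k(Dg_i(x^k)^\top\Gamma_i\tilde g_i(x^k))(Dg_i(x^k)^\top\Gamma_i\tilde g_i(x^k))^\top+\sum_{i\in I_0(x^* )}\theta_i^kDg_i(x^k)^\top Dg_i(x^k)+\delta_kI_n\Big)d\ge0.$$ *)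

theory Defs
  imports "HOL-Analysis.Analysis"
begin

text \<open>
  The spaces \<open>\<real>\<^sup>n\<close> and \<open>\<real>\<^sup>p\<close> are \<open>real^'n\<close> and \<open>real^'p\<close>. The blocks \<open>\<real> \<times> \<real>\<^bsup>m\<^sub>i-1\<^esup>\<close>
  (\<open>i :: 'r\<close>) have different dimensions and all live in one ambient space \<open>real^('m option)\<close>:
  the index \<open>None\<close> carries \<open>w\<^sub>0\<close>, and the entries of the tail are indexed by \<open>Some j\<close> with
  \<open>j \<in> J i\<close>, where \<open>J i\<close> is an arbitrary, possibly empty, set and \<open>m\<^sub>i = card (J i) + 1\<close>. So block
  \<open>i\<close> is the coordinate subspace \<open>block_space (J i)\<close>, with the inherited Euclidean structure.
  The product of the blocks sits in \<open>(real^('m option))^'r\<close>, whose norm is Euclidean.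
\<close>

type_synonym 'm blk = "real^('m option)"

definition block_space :: "'m::finite set \<Rightarrow> 'm blk set" where
  "block_space J = {w. \<forall>j. j \<notin> J \<longrightarrow> w $ Some j = 0}"

definition tail :: "'m::finite blk \<Rightarrow> real^'m" where
  "tail w = (\<chi> j. w $ Some j)"

definition blk :: "real \<Rightarrow> real^'m::finite \<Rightarrow> 'm blk" where
  "blk a v = (\<chi> c. case c of None \<Rightarrow> a | Some j \<Rightarrow> v $ j)"

text \<open>For \<open>J = {}\<close>, that is \<open>m\<^sub>i = 1\<close>, the tail vanishes on the block and the cone is the
  half-line \<open>w\<^sub>0 \<ge> 0\<close>.\<close>

definition soc :: "'m::finite set \<Rightarrow> 'm blk set" where
  "soc J = {w \<in> block_space J. w $ None \<ge> norm (tail w)}"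

definition soc_bd_plus :: "'m::finite set \<Rightarrow> 'm blk set" where
  "soc_bd_plus J = {w \<in> block_space J. w $ None = norm (tail w) \<and> norm (tail w) \<noteq> 0}"

definition soc_prod :: "('r::finite \<Rightarrow> 'm::finite set) \<Rightarrow> ('m blk^'r) set" where
  "soc_prod J = {w. \<forall>i. w $ i \<in> soc (J i)}"

definition jordan_prod :: "'m::finite blk \<Rightarrow> 'm blk \<Rightarrow> 'm blk" where
  "jordan_prod y z = blk (y \<bullet> z) (y $ None *\<^sub>R tail z + z $ None *\<^sub>R tail y)"

text \<open>\<open>\<Gamma>\<^sub>i\<close> extended to the ambient space. Its additional diagonal entries only ever meet
  coordinates outside block \<open>i\<close>, which vanish identically along \<open>g\<^sub>i\<close>.\<close>

definition Gamma_mat :: "real^('m::finite option)^('m option)" where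
  "Gamma_mat = (\<chi> a b. if a = b then (if a = None then 1 else - 1) else 0)"

definition outer :: "real^'n \<Rightarrow> real^'n \<Rightarrow> real^'n^'n" where
  "outer v w = (\<chi> a b. v $ a * w $ b)"


definition twice_cont_diff :: "('a::real_normed_vector \<Rightarrow> 'b::real_normed_vector) \<Rightarrow> bool" where
  "twice_cont_diff F \<longleftrightarrow>
    (\<exists>(F' :: 'a \<Rightarrow> 'a \<Rightarrow>\<^sub>L 'b) (F'' :: 'a \<Rightarrow> 'a \<Rightarrow>\<^sub>L ('a \<Rightarrow>\<^sub>L 'b)).
       (\<forall>x. (F has_derivative blinfun_apply (F' x)) (at x)) \<and>
       (\<forall>x. (F' has_derivative blinfun_apply (F'' x)) (at x)) \<and>
       continuous_on UNIV F'')"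

definition grad :: "('a::real_inner \<Rightarrow> real) \<Rightarrow> 'a \<Rightarrow> 'a" where
  "grad F x = (THE D. GDERIV F x :> D)"

definition hessian :: "(real^'n \<Rightarrow> real) \<Rightarrow> real^'n \<Rightarrow> real^'n^'n" where
  "hessian F x = jacobian (grad F) (at x)"

definition local_minimizer :: "('a::metric_space \<Rightarrow> real) \<Rightarrow> 'a set \<Rightarrow> 'a \<Rightarrow> bool" where
  "local_minimizer F S x \<longleftrightarrow>
     x \<in> S \<and> (\<exists>\<epsilon>>0. \<forall>y\<in>S. dist y x < \<epsilon> \<longrightarrow> F x \<le> F y)"

definition generalized_Lojasiewicz :: "('a::real_inner \<Rightarrow> real) \<Rightarrow> 'a \<Rightarrow> bool" where
  "generalized_Lojasiewicz Q xstar \<longleftrightarrow>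
     (\<exists>\<delta>>0. \<exists>\<theta> :: 'a \<Rightarrow> real. (\<theta> \<longlongrightarrow> 0) (at xstar) \<and>
        (\<forall>x\<in>ball xstar \<delta>. \<bar>Q x - Q xstar\<bar> \<le> \<theta> x * norm (grad Q x)))"


definition feasible_set ::
  "('r::finite \<Rightarrow> 'm::finite set) \<Rightarrow> (real^'n \<Rightarrow> 'm blk^'r) \<Rightarrow> (real^'n \<Rightarrow> real^'p) \<Rightarrow> (real^'n) set"
where
  "feasible_set J g h = {x. (\<forall>i. g x $ i \<in> soc (J i)) \<and> h x = 0}"

definition I0 :: "(real^'n \<Rightarrow> ('m::finite) blk^('r::finite)) \<Rightarrow> real^'n \<Rightarrow> 'r set" where
  "I0 g x = {i. g x $ i = 0}"

definition IB ::
  "('r::finite \<Rightarrow> 'm::finite set) \<Rightarrow> (real^'n \<Rightarrow> 'm blk^'r) \<Rightarrow> real^'n \<Rightarrow> 'r set" where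
  "IB J g x = {i. g x $ i \<in> soc_bd_plus (J i)}"

definition lagrangian ::
  "(real^'n \<Rightarrow> real) \<Rightarrow> (real^'n \<Rightarrow> ('m::finite) blk^('r::finite)) \<Rightarrow> (real^'n \<Rightarrow> real^'p)
    \<Rightarrow> real^'n \<Rightarrow> real^'p \<Rightarrow> 'm blk^'r \<Rightarrow> real"
where
  "lagrangian f g h x \<mu> \<omega> = f x + h x \<bullet> \<mu> - g x \<bullet> \<omega>"

definition penalty ::
  "('r::finite \<Rightarrow> 'm::finite set) \<Rightarrow> (real^'n \<Rightarrow> real) \<Rightarrow> (real^'n \<Rightarrow> 'm blk^'r)
    \<Rightarrow> (real^'n \<Rightarrow> real^'p) \<Rightarrow> real^'n \<Rightarrow> real \<Rightarrow> real^'n \<Rightarrow> real"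
where
  "penalty J f g h xstar \<rho> x =
     f x + 1/4 * norm (x - xstar) ^ 4
     + \<rho> / 2 * ((\<Sum>i\<in>UNIV. (norm (closest_point (soc (J i)) (- (g x $ i))))\<^sup>2) + (norm (h x))\<^sup>2)"

definition infeasibility ::
  "('r::finite \<Rightarrow> 'm::finite set) \<Rightarrow> (real^'n \<Rightarrow> 'm blk^'r) \<Rightarrow> (real^'n \<Rightarrow> real^'p) \<Rightarrow> real^'n \<Rightarrow> real"
where
  "infeasibility J g h x =
     1/2 * (norm (h x))\<^sup>2 + 1/2 * (norm (closest_point (soc_prod J) (- g x)))\<^sup>2"

definition Dg :: "(real^'n \<Rightarrow> ('m::finite) blk^('r::finite)) \<Rightarrow> 'r \<Rightarrow> real^'n \<Rightarrow> real^'n^('m option)"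
where
  "Dg g i x = jacobian (\<lambda>y. g y $ i) (at x)"

definition g_tilde :: "(real^'n \<Rightarrow> ('m::finite) blk^('r::finite)) \<Rightarrow> 'r \<Rightarrow> real^'n \<Rightarrow> 'm blk" where
  "g_tilde g i x = blk (norm (tail (g x $ i))) (tail (g x $ i))"

definition sigma_mat ::
  "('r::finite \<Rightarrow> 'm::finite set) \<Rightarrow> (real^'n \<Rightarrow> 'm blk^'r) \<Rightarrow> real^'n
    \<Rightarrow> real^'n \<Rightarrow> 'm blk^'r \<Rightarrow> real^'n^'n"
where
  "sigma_mat J g xstar x \<omega> =
     (\<Sum>i\<in>IB J g xstar. (- (\<omega> $ i $ None / (g x $ i $ None))) *\<^sub>R
        (transpose (Dg g i x) ** Gamma_mat ** Dg g i x))"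


definition CAKKT_seq ::
  "('r::finite \<Rightarrow> 'm::finite set) \<Rightarrow> (real^'n \<Rightarrow> real) \<Rightarrow> (real^'n \<Rightarrow> 'm blk^'r)
    \<Rightarrow> (real^'n \<Rightarrow> real^'p) \<Rightarrow> real^'n
    \<Rightarrow> (nat \<Rightarrow> real^'n) \<Rightarrow> (nat \<Rightarrow> real^'p) \<Rightarrow> (nat \<Rightarrow> 'm blk^'r) \<Rightarrow> bool"
where
  "CAKKT_seq J f g h xstar x \<mu> \<omega> \<longleftrightarrow>
     xstar \<in> feasible_set J g h \<and> x \<longlonglongrightarrow> xstar \<and> (\<forall>k. \<omega> k \<in> soc_prod J) \<and>
     (\<lambda>k. grad (\<lambda>y. lagrangian f g h y (\<mu> k) (\<omega> k)) (x k)) \<longlonglongrightarrow> 0 \<and>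
     (\<forall>i. (\<lambda>k. jordan_prod (g (x k) $ i) (\<omega> k $ i)) \<longlonglongrightarrow> 0) \<and>
     (\<forall>i. (\<lambda>k. h (x k) $ i * \<mu> k $ i) \<longlonglongrightarrow> 0)"

definition CAKKT2_mat ::
  "('r::finite \<Rightarrow> 'm::finite set) \<Rightarrow> (real^'n \<Rightarrow> real) \<Rightarrow> (real^'n \<Rightarrow> 'm blk^'r)
    \<Rightarrow> (real^'n \<Rightarrow> real^'p) \<Rightarrow> real^'n
    \<Rightarrow> real^'n \<Rightarrow> real^'p \<Rightarrow> 'm blk^'r \<Rightarrow> real^'p \<Rightarrow> ('r \<Rightarrow> real) \<Rightarrow> ('r \<Rightarrow> real) \<Rightarrow> real
    \<Rightarrow> real^'n^'n"
where
  "CAKKT2_mat J f g h xstar x \<mu> \<omega> \<eta> \<theta> \<gamma> \<delta> =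
     hessian (\<lambda>y. lagrangian f g h y \<mu> \<omega>) x
     + sigma_mat J g xstar x \<omega>
     + (\<Sum>i\<in>UNIV. \<eta> $ i *\<^sub>R outer (grad (\<lambda>y. h y $ i) x) (grad (\<lambda>y. h y $ i) x))
     + (\<Sum>i\<in>IB J g xstar. \<gamma> i *\<^sub>R
          outer ((transpose (Dg g i x) ** Gamma_mat) *v g_tilde g i x)
                ((transpose (Dg g i x) ** Gamma_mat) *v g_tilde g i x))
     + (\<Sum>i\<in>I0 g xstar. \<theta> i *\<^sub>R (transpose (Dg g i x) ** Dg g i x))
     + \<delta> *\<^sub>R mat 1"

definition CAKKT2 ::
  "('r::finite \<Rightarrow> 'm::finite set) \<Rightarrow> (real^'n \<Rightarrow> real) \<Rightarrow> (real^'n \<Rightarrow> 'm blk^'r)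
    \<Rightarrow> (real^'n \<Rightarrow> real^'p) \<Rightarrow> real^'n \<Rightarrow> bool"
where
  "CAKKT2 J f g h xstar \<longleftrightarrow>
     (\<exists>x \<mu> \<omega>. CAKKT_seq J f g h xstar x \<mu> \<omega> \<and>
       (\<exists>(\<eta> :: nat \<Rightarrow> real^'p) (\<theta> :: nat \<Rightarrow> 'r \<Rightarrow> real) (\<gamma> :: nat \<Rightarrow> 'r \<Rightarrow> real) (\<delta> :: nat \<Rightarrow> real).
          (\<forall>k. \<delta> k \<ge> 0) \<and> \<delta> \<longlonglongrightarrow> 0 \<and>
          (\<forall>\<^sub>F k in sequentially. \<forall>d.
             d \<bullet> (CAKKT2_mat J f g h xstar (x k) (\<mu> k) (\<omega> k) (\<eta> k) (\<theta> k) (\<gamma> k) (\<delta> k) *v d) \<ge> 0)))"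

text \<open>Hypothesis (a). The index set is \<open>{k. g\<^sub>i(x\<^sub>k) \<notin> K\<^sub>i \<union> - K\<^sub>i}\<close>; recall that \<open>g\<^sub>i\<close> takes
  values in block \<open>i\<close>.\<close>

definition bounded_multipliers ::
  "('r::finite \<Rightarrow> 'm::finite set) \<Rightarrow> (real^'n \<Rightarrow> real) \<Rightarrow> (real^'n \<Rightarrow> 'm blk^'r)
    \<Rightarrow> (real^'n \<Rightarrow> real^'p) \<Rightarrow> real^'n \<Rightarrow> bool"
where
  "bounded_multipliers J f g h xstar \<longleftrightarrow>
     (\<forall>(\<rho> :: nat \<Rightarrow> real) (x :: nat \<Rightarrow> real^'n).
        filterlim \<rho> at_top sequentially \<longrightarrow> x \<longlonglongrightarrow> xstar \<longrightarrow>
        (\<forall>k. local_minimizer (penalty J f g h xstar (\<rho> k)) UNIV (x k)) \<longrightarrow>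
        (\<forall>i\<in>IB J g xstar.
           bounded ((\<lambda>k. (\<rho> k *\<^sub>R closest_point (soc (J i)) (- (g (x k) $ i))) $ None) `
             {k. g (x k) $ i \<in> block_space (J i) - (soc (J i) \<union> uminus ` soc (J i))})))"

end

theory Submission
  imports Defs
begin

text \<open>
  Near \<open>xstar\<close>, minimize \<open>f + |x - xstar|\<^sup>4 / 4 + \<rho>\<^sub>k V\<close>, where \<open>V\<close> is half the sum of the squared distances
  of \<open>g\<^sub>i (x)\<close> to the cones and of \<open>|h (x)|\<^sup>2\<close>. The quartic term makes \<open>xstar\<close> a strict minimizer, so the
  minimizers \<open>x\<^sub>k\<close> converge to \<open>xstar\<close>, and comparing values gives \<open>\<rho>\<^sub>k V (x\<^sub>k) \<longlonglongrightarrow> 0\<close>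
  (\<open>penalty_minimizers\<close>). Put \<open>\<mu> = \<rho> h\<close> and \<open>\<omega>\<^sub>i = \<rho> y\<^sub>i\<close>, where \<open>y\<^sub>i = \<Pi> (- g\<^sub>i)\<close> is the gap between \<open>g\<^sub>i\<close>
  and its projection. Stationarity says that the gradient of the Lagrangian is
  \<open>- |x - xstar|\<^sup>2 (x - xstar)\<close>. The Jordan product of \<open>g\<^sub>i\<close> and \<open>y\<^sub>i\<close> has norm at most \<open>2 |y\<^sub>i|\<^sup>2\<close>
  (\<open>norm_jordan_gap\<close>), so both complementarity conditions follow from \<open>\<rho> V \<longlonglongrightarrow> 0\<close>.

  For the second-order condition the penalty function, which is not twice differentiable, is
  replaced along each line by a smooth majorant that touches it at the minimizer. For a block with
  \<open>g\<^sub>i (xstar) = 0\<close> the majorant is half the squared distance to the fixed projection, whose curvature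
  contributes \<open>\<rho> Dg\<^sub>i\<^sup>T Dg\<^sub>i\<close> (\<open>upper_jet_dist_fixed_point\<close>). A block in the interior of the cone at
  \<open>xstar\<close> contributes nothing. For a block in the boundary at \<open>xstar\<close>, away from \<open>0\<close>, the majorant is
  \<open>(|tail g\<^sub>i| - g\<^sub>i\<^sub>0)\<^sup>2 / 4\<close>, unless \<open>g\<^sub>i (x\<^sub>k)\<close> is interior to the cone, when \<open>0\<close> serves
  (\<open>upper_jet_dist_boundary\<close>). In the former case let \<open>s = |tail g\<^sub>i| - g\<^sub>i\<^sub>0 \<ge> 0\<close>. The curvature of the
  cone yields \<open>\<omega>\<^sub>i\<^sub>0 / |tail g\<^sub>i|\<close> times the squared non-radial part of the derivative of the tail.
  Replacing this by the term \<open>\<sigma>\<close> of the condition changes the coefficient by \<open>\<rho> s\<^sup>2\<close> up to a bounded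
  factor, hence by a null sequence, and creates a cross term between the derivatives of \<open>s\<close> and of
  \<open>g\<^sub>i\<^sub>0\<close>. Since \<open>\<gamma>\<^sub>i\<close> may grow arbitrarily fast, Young's inequality moves nearly all of the cross
  term into the square that \<open>\<gamma>\<^sub>i\<close> multiplies and leaves a remainder of order \<open>1 / \<rho>\<close>
  (\<open>boundary_curvature_estimate\<close>). All remainders are collected in \<open>\<delta>\<^sub>k\<close>.
\<close>

section \<open>Projection onto the second-order cone\<close>

lemma tail_simps [simp]:
  "tail (x + y) = tail x + tail y" "tail (x - y) = tail x - tail y"
  "tail (- x) = - tail x" "tail (c *\<^sub>R x) = c *\<^sub>R tail x" "tail 0 = 0"
  by (simp_all add: tail_def vec_eq_iff)

lemma blk_simps [simp]: "blk a v $ None = a" "tail (blk a v) = v" "blk a v $ Some j = v $ j"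
  by (simp_all add: blk_def tail_def vec_eq_iff)

lemma inner_block: "x \<bullet> y = x $ None * y $ None + tail x \<bullet> tail y"
  by (simp add: inner_vec_def UNIV_option_conv sum.reindex tail_def)

lemma norm_block_sq: "(norm x)\<^sup>2 = (x $ None)\<^sup>2 + (norm (tail x))\<^sup>2"
  unfolding power2_norm_eq_inner inner_block[of x x] by (simp add: power2_eq_square)

lemma block_eqI: "x $ None = y $ None \<Longrightarrow> tail x = tail y \<Longrightarrow> x = y"
  by (metis (mono_tags, lifting) inner_block inner_eq_zero_iff inner_zero_left right_minus_eq
      tail_simps(2) vector_minus_component mult_zero_left add.right_neutral cancel_comm_monoid_add_class.diff_cancel)

lemma bounded_linear_tail: "bounded_linear tail"
  unfolding linear_conv_bounded_linear[symmetric] by (intro linearI) simp_all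

lemma subspace_block_space: "subspace (block_space J)"
  by (auto simp: subspace_def block_space_def)

lemma blk_in_block_space: "w \<in> block_space J \<Longrightarrow> blk a (c *\<^sub>R tail w) \<in> block_space J"
  by (auto simp: block_space_def tail_def)

lemma soc_iff: "w \<in> soc J \<longleftrightarrow> w \<in> block_space J \<and> norm (tail w) \<le> w $ None"
  by (simp add: soc_def)

lemma zero_in_soc: "0 \<in> soc J"
  by (simp add: soc_iff subspace_0 subspace_block_space)

lemma scaleR_in_soc: "0 \<le> c \<Longrightarrow> w \<in> soc J \<Longrightarrow> c *\<^sub>R w \<in> soc J"
  by (auto simp: soc_iff subspace_scale subspace_block_space mult_left_mono)

lemma convex_soc: "convex (soc J)"
proof (rule convexI)
  fix x y :: "'a blk" and u v :: real
  assume a: "x \<in> soc J" "y \<in> soc J" "0 \<le> u" "0 \<le> v"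
  have "norm (u *\<^sub>R tail x + v *\<^sub>R tail y) \<le> u * norm (tail x) + v * norm (tail y)"
    using a norm_triangle_ineq[of "u *\<^sub>R tail x" "v *\<^sub>R tail y"] by simp
  also have "\<dots> \<le> u * x $ None + v * y $ None"
    using a by (intro add_mono mult_left_mono) (auto simp: soc_iff)
  finally show "u *\<^sub>R x + v *\<^sub>R y \<in> soc J"
    using a by (auto simp: soc_iff subspace_scale subspace_add subspace_block_space)
qed

lemma closed_soc: "closed (soc J)"
proof -
  have "soc J = block_space J \<inter> {w. norm (tail w) \<le> w $ None}"
    by (auto simp: soc_iff)
  moreover have "closed {w :: 'a blk. norm (tail w) \<le> w $ None}"
    by (intro closed_Collect_le continuous_intros linear_continuous_on bounded_linear_tail)
  ultimately show ?thesis
    using closed_subspace[OF subspace_block_space] by (metis closed_Int)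
qed

text \<open>
  This is \<open>\<Pi>\<^sub>K (- w)\<close>, by Moreau's decomposition and self-duality of the cone. Writing it as the
  residual of the projection of \<open>w\<close> itself makes it the negative gradient of half the squared distance,
  so that the multiplier estimate \<open>\<omega> = \<rho> \<Pi>\<^sub>K (- g)\<close> appears directly when the penalty term is
  differentiated.
\<close>
definition gap :: "'m::finite set \<Rightarrow> 'm blk \<Rightarrow> 'm blk" where
  "gap J w = closest_point (soc J) w - w"

definition half_sq_dist :: "'m::finite set \<Rightarrow> 'm blk \<Rightarrow> real" where
  "half_sq_dist J w = (norm (gap J w))\<^sup>2 / 2"

lemma closest_in_soc: "closest_point (soc J) w \<in> soc J"
  using closest_point_in_set[OF closed_soc] zero_in_soc by blast

lemma half_sq_dist_le: "p \<in> soc J \<Longrightarrow> half_sq_dist J w \<le> (norm (w - p))\<^sup>2 / 2"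
  using closest_point_le[OF closed_soc, of p J w]
  by (simp add: half_sq_dist_def gap_def dist_norm norm_minus_commute power_mono)

lemma half_sq_dist_nonneg: "0 \<le> half_sq_dist J w"
  by (simp add: half_sq_dist_def)

lemma gap_eq_0_iff: "gap J w = 0 \<longleftrightarrow> w \<in> soc J"
  using closest_in_soc[of J w] closest_point_self[of w "soc J"] by (auto simp: gap_def)

lemma half_sq_dist_eq_0_iff: "half_sq_dist J w = 0 \<longleftrightarrow> w \<in> soc J"
  by (simp add: half_sq_dist_def gap_eq_0_iff)

lemma continuous_on_half_sq_dist: "continuous_on S (half_sq_dist J)"
proof -
  have "soc J \<noteq> {}" using zero_in_soc by blast
  then show ?thesis unfolding half_sq_dist_def gap_def
    by (auto intro!: continuous_intros continuous_on_closest_point convex_soc closed_soc)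
qed

lemma
  shows gap_orthogonal: "closest_point (soc J) w \<bullet> gap J w = 0"
    and gap_dual: "z \<in> soc J \<Longrightarrow> 0 \<le> z \<bullet> gap J w"
proof -
  let ?p = "closest_point (soc J) w"
  have *: "0 \<le> (z - ?p) \<bullet> gap J w" if "z \<in> soc J" for z
    using closest_point_dot[OF convex_soc closed_soc that, of w]
    by (simp add: gap_def inner_commute algebra_simps)
  show 0: "?p \<bullet> gap J w = 0"
    using *[OF zero_in_soc] *[OF scaleR_in_soc[OF _ closest_in_soc, of 2 J w]]
    by (simp add: scaleR_2)
  show "0 \<le> z \<bullet> gap J w" if "z \<in> soc J"
    using *[OF that] 0 by (simp add: inner_diff_left)
qed

text \<open>
  Self-duality of the cone: the gap is nonnegative on the cone, and testing it against the ray opposite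
  to its own tail gives the defining inequality.
\<close>
lemma gap_in_soc:
  assumes w: "w \<in> block_space J"
  shows "gap J w \<in> soc J"
proof -
  let ?y = "gap J w"
  have y: "?y \<in> block_space J"
    unfolding gap_def using closest_in_soc[of J w] w
    by (simp add: soc_iff subspace_diff subspace_block_space)
  have "norm (tail ?y) \<le> ?y $ None"
  proof (cases "tail ?y = 0")
    case True
    have "blk 1 (0 *\<^sub>R tail ?y) \<in> soc J"
      using blk_in_block_space[OF y, of 1 0] by (simp add: soc_iff)
    from gap_dual[OF this, of w] True show ?thesis by (simp add: inner_block)
  next
    case False
    have "blk (norm (tail ?y)) ((-1) *\<^sub>R tail ?y) \<in> soc J"
      using blk_in_block_space[OF y, of "norm (tail ?y)" "-1"] by (simp add: soc_iff)
    from gap_dual[OF this, of w]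
    have "norm (tail ?y) * norm (tail ?y) \<le> norm (tail ?y) * ?y $ None"
      by (simp add: inner_block power2_norm_eq_inner[symmetric] power2_eq_square)
    then show ?thesis using False by (simp add: mult_le_cancel_left)
  qed
  then show ?thesis using y by (simp add: soc_iff)
qed

text \<open>
  Orthogonal elements of the cone satisfy the equality case of Cauchy-Schwarz for their tails,
  \<open>p\<^sub>0 y\<^sub>0 = - \<langle>tail p, tail y\<rangle> \<le> |tail p| |tail y| \<le> p\<^sub>0 y\<^sub>0\<close>; expanding the square of the tail of the
  Jordan product then leaves nothing.
\<close>
lemma jordan_prod_orthogonal:
  assumes "p \<in> soc J" "y \<in> soc J" "p \<bullet> y = 0"
  shows "jordan_prod p y = 0"
proof -
  have o: "tail p \<bullet> tail y = - (p $ None * y $ None)"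
    using assms(3) by (simp add: inner_block)
  have b: "norm (tail p) \<le> p $ None" "norm (tail y) \<le> y $ None"
    using assms by (auto simp: soc_iff)
  have p0: "0 \<le> p $ None" "0 \<le> y $ None"
    using b norm_ge_zero order_trans by blast+
  have p0y0: "0 \<le> p $ None * y $ None" using p0 by simp
  have "(norm (p $ None *\<^sub>R tail y + y $ None *\<^sub>R tail p))\<^sup>2
      = (p $ None)\<^sup>2 * (norm (tail y))\<^sup>2 + (y $ None)\<^sup>2 * (norm (tail p))\<^sup>2
        + 2 * (p $ None * y $ None * (tail p \<bullet> tail y))"
    unfolding power2_norm_eq_inner
    by (simp add: inner_add power2_eq_square inner_commute algebra_simps)
  also have "\<dots> \<le> (p $ None)\<^sup>2 * (y $ None)\<^sup>2 + (y $ None)\<^sup>2 * (p $ None)\<^sup>2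
        + 2 * (p $ None * y $ None * (tail p \<bullet> tail y))"
    using b by (intro add_mono mult_left_mono power_mono) (use p0 in auto)
  also have "\<dots> = 0" unfolding o by (simp add: power2_eq_square)
  finally have "p $ None *\<^sub>R tail y + y $ None *\<^sub>R tail p = 0" by simp
  then show ?thesis using assms(3)
    by (intro block_eqI) (simp_all add: jordan_prod_def)
qed

lemma norm_jordan_self:
  assumes "y \<in> soc J"
  shows "norm (jordan_prod y y) \<le> 2 * (norm y)\<^sup>2"
proof -
  have b: "norm (tail y) \<le> y $ None" "0 \<le> y $ None"
    using assms order_trans[OF norm_ge_zero, of "tail y" "y $ None"] by (auto simp: soc_iff)
  have "jordan_prod y y = blk ((norm y)\<^sup>2) ((2 * y $ None) *\<^sub>R tail y)"
    unfolding power2_norm_eq_inner by (simp add: jordan_prod_def flip: scaleR_2)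
  then have "(norm (jordan_prod y y))\<^sup>2 = ((norm y)\<^sup>2)\<^sup>2 + (2 * y $ None * norm (tail y))\<^sup>2"
    unfolding norm_block_sq[of "jordan_prod y y"] by (simp add: power_mult_distrib)
  also have "\<dots> \<le> ((norm y)\<^sup>2)\<^sup>2 + ((norm y)\<^sup>2)\<^sup>2"
  proof (intro add_mono power_mono order_refl)
    show "2 * y $ None * norm (tail y) \<le> (norm y)\<^sup>2"
      unfolding norm_block_sq by (rule sum_squares_bound)
  qed (use b in auto)
  also have "\<dots> \<le> (2 * (norm y)\<^sup>2)\<^sup>2" by (simp add: power_mult_distrib)
  finally show ?thesis by (rule power2_le_imp_le) simp
qed

text \<open>
  With \<open>w = p - y\<close>, where \<open>p\<close> is the projection and \<open>y\<close> the gap, the product \<open>p \<circ> y\<close> vanishes and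
  only \<open>y \<circ> y\<close> remains. This quadratic bound is what turns \<open>\<rho> dist\<^sup>2 \<longlonglongrightarrow> 0\<close> into the complementarity
  condition, no matter how fast the multipliers \<open>\<rho> y\<close> grow.
\<close>
lemma norm_jordan_gap:
  assumes "w \<in> block_space J"
  shows "norm (jordan_prod w (gap J w)) \<le> 2 * (norm (gap J w))\<^sup>2"
proof -
  let ?y = "gap J w" and ?p = "closest_point (soc J) w"
  have "jordan_prod w ?y = jordan_prod ?p ?y - jordan_prod ?y ?y"
    by (intro block_eqI) (simp_all add: jordan_prod_def gap_def inner_diff_left inner_diff_right algebra_simps)
  then have "norm (jordan_prod w ?y) = norm (jordan_prod ?y ?y)"
    using jordan_prod_orthogonal[OF closest_in_soc gap_in_soc[OF assms] gap_orthogonal] by simp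
  then show ?thesis using norm_jordan_self[OF gap_in_soc[OF assms]] by simp
qed

text \<open>
  The bound is half the squared distance to the point on the boundary of the cone that has the tail
  direction of \<open>w\<close> and whose first component is the mean of \<open>w\<^sub>0\<close> and \<open>|tail w|\<close>. It also holds inside the cone, where it is not sharp: this makes its right-hand side a
  smooth majorant on both sides of the boundary.
\<close>
lemma half_sq_dist_le_tail_excess:
  assumes w: "w \<in> block_space J" and w0: "0 < w $ None" and t: "tail w \<noteq> 0"
  shows "half_sq_dist J w \<le> (norm (tail w) - w $ None)\<^sup>2 / 4"
proof -
  let ?n = "norm (tail w)"
  define c where "c = (?n + w $ None) / 2"
  define p where "p = blk c ((c / ?n) *\<^sub>R tail w)"
  have c: "0 < c" using w0 t by (simp add: c_def add_pos_pos)
  have p: "p \<in> soc J"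
    using blk_in_block_space[OF w, of c "c / ?n"] c t by (simp add: p_def soc_iff)
  have "tail (w - p) = (1 - c / ?n) *\<^sub>R tail w" by (simp add: p_def scaleR_diff_left)
  then have "norm (tail (w - p)) = \<bar>(1 - c / ?n) * ?n\<bar>" by (simp add: abs_mult)
  also have "(1 - c / ?n) * ?n = (?n - w $ None) / 2"
    using t by (simp add: field_simps c_def)
  finally have "(norm (tail (w - p)))\<^sup>2 = ((?n - w $ None) / 2)\<^sup>2" by (simp only: power2_abs)
  moreover have "((w - p) $ None)\<^sup>2 = ((?n - w $ None) / 2)\<^sup>2"
    by (simp add: p_def c_def power2_eq_square field_simps)
  ultimately have "(norm (w - p))\<^sup>2 / 2 = (?n - w $ None)\<^sup>2 / 4"
    unfolding norm_block_sq by (simp add: power_divide)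
  with half_sq_dist_le[OF p, of w] show ?thesis by simp
qed

lemma gap_outside:
  assumes w: "w \<in> block_space J" and w0: "0 < w $ None" and out: "w $ None \<le> norm (tail w)"
  defines "s \<equiv> norm (tail w) - w $ None"
  shows "gap J w = blk (s / 2) (- (s / (2 * norm (tail w))) *\<^sub>R tail w)"
    and "half_sq_dist J w = s\<^sup>2 / 4"
proof -
  let ?n = "norm (tail w)"
  have n: "0 < ?n" using w0 out by linarith
  define c where "c = (?n + w $ None) / 2"
  define p where "p = blk c ((c / ?n) *\<^sub>R tail w)"
  have c: "0 < c" using w0 n by (simp add: c_def add_pos_pos)
  have p: "p \<in> soc J"
    using blk_in_block_space[OF w, of c "c / ?n"] c n by (simp add: p_def soc_iff)
  have pw: "p - w = blk (s / 2) (- (s / (2 * ?n)) *\<^sub>R tail w)"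
  proof (intro block_eqI)
    show "(p - w) $ None = blk (s / 2) (- (s / (2 * ?n)) *\<^sub>R tail w) $ None"
      by (simp add: p_def c_def s_def field_simps)
    have "c / ?n - 1 = - (s / (2 * ?n))"
      using n by (simp add: c_def s_def field_simps)
    moreover have "tail (p - w) = (c / ?n - 1) *\<^sub>R tail w" by (simp add: p_def scaleR_diff_left)
    ultimately show "tail (p - w) = tail (blk (s / 2) (- (s / (2 * ?n)) *\<^sub>R tail w))" by simp
  qed
  have nw: "(norm (p - w))\<^sup>2 = s\<^sup>2 / 2"
    using n by (simp add: pw norm_block_sq power_mult_distrib power_divide)
  have "p = closest_point (soc J) w"
  proof (rule closest_point_unique[OF convex_soc closed_soc p], intro ballI)
    fix z assume z: "z \<in> soc J"
    have "s \<le> ?n - norm (tail z) + (z $ None - w $ None)" using z by (simp add: s_def soc_iff)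
    also have "\<dots> \<le> norm (tail (w - z)) + \<bar>(w - z) $ None\<bar>"
      using norm_triangle_ineq2[of "tail w" "tail z"] by simp
    \<comment> \<open>any point of the cone misses \<open>w\<close> by at least \<open>s\<close>, measured by \<open>|tail z| + |z\<^sub>0|\<close>\<close>
    finally have "s\<^sup>2 \<le> (norm (tail (w - z)) + \<bar>(w - z) $ None\<bar>)\<^sup>2"
      using out by (intro power_mono) (auto simp: s_def)
    also have "\<dots> \<le> 2 * ((norm (tail (w - z)))\<^sup>2 + ((w - z) $ None)\<^sup>2)"
      using sum_squares_bound[of "norm (tail (w - z))" "\<bar>(w - z) $ None\<bar>"]
      by (simp only: power2_sum power2_abs) simp
    also have "\<dots> = 2 * (norm (w - z))\<^sup>2" by (simp only: norm_block_sq add.commute)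
    finally have "(norm (p - w))\<^sup>2 \<le> (norm (w - z))\<^sup>2" by (simp add: nw)
    then show "dist w p \<le> dist w z"
      by (metis dist_norm norm_minus_commute norm_ge_zero power2_le_imp_le)
  qed
  then have g: "gap J w = p - w" by (simp add: gap_def)
  then show "gap J w = blk (s / 2) (- (s / (2 * ?n)) *\<^sub>R tail w)" by (simp add: pw)
  show "half_sq_dist J w = s\<^sup>2 / 4" by (simp add: half_sq_dist_def g nw)
qed

section \<open>Second-order conditions through upper jets\<close>

text \<open>
  The squared distance to the cone is only \<open>C\<^bsup>1,1\<^esup>\<close>, so a minimizer of the penalty function has no
  Hessian there. A smooth function lying above and touching at \<open>0\<close> inherits the minimum, and its
  second derivative must be nonnegative. The pair \<open>(a, A)\<close> of its first two derivatives is an element of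
  the second-order superjet, as in the theory of viscosity solutions.
\<close>
definition upper_jet :: "(real \<Rightarrow> real) \<Rightarrow> real \<Rightarrow> real \<Rightarrow> bool" where
  "upper_jet \<phi> a A \<longleftrightarrow> (\<exists>m m'. m 0 = \<phi> 0 \<and>
     (\<forall>\<^sub>F t in nhds 0. \<phi> t \<le> m t \<and> (m has_real_derivative m' t) (at t)) \<and>
     m' 0 = a \<and> (m' has_real_derivative A) (at 0))"

lemma upper_jetI:
  assumes "m 0 = \<phi> 0" "\<forall>\<^sub>F t in nhds 0. \<phi> t \<le> m t"
    "\<forall>\<^sub>F t in nhds 0. (m has_real_derivative m' t) (at t)"
    "m' 0 = a" "(m' has_real_derivative A) (at 0)"
  shows "upper_jet \<phi> a A"
  unfolding upper_jet_def using assms by (intro exI[of _ m] exI[of _ m']) (auto intro: eventually_conj)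

lemma upper_jet_smooth:
  assumes "\<And>t. (\<phi> has_real_derivative m' t) (at t)" "(m' has_real_derivative A) (at 0)"
  shows "upper_jet \<phi> (m' 0) A"
  using assms by (intro upper_jetI[where m = \<phi> and m' = m']) auto

lemma upper_jet_add:
  assumes "upper_jet \<phi> a A" "upper_jet \<psi> b B"
  shows "upper_jet (\<lambda>t. \<phi> t + \<psi> t) (a + b) (A + B)"
proof -
  obtain m m' where m: "m 0 = \<phi> 0" "m' 0 = a" "(m' has_real_derivative A) (at 0)"
    "\<forall>\<^sub>F t in nhds 0. \<phi> t \<le> m t \<and> (m has_real_derivative m' t) (at t)"
    using assms(1) unfolding upper_jet_def by blast
  obtain l l' where l: "l 0 = \<psi> 0" "l' 0 = b" "(l' has_real_derivative B) (at 0)"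
    "\<forall>\<^sub>F t in nhds 0. \<psi> t \<le> l t \<and> (l has_real_derivative l' t) (at t)"
    using assms(2) unfolding upper_jet_def by blast
  have "\<forall>\<^sub>F t in nhds 0. \<phi> t + \<psi> t \<le> m t + l t"
    and "\<forall>\<^sub>F t in nhds 0. ((\<lambda>t. m t + l t) has_real_derivative m' t + l' t) (at t)"
    using m(4) l(4) by (eventually_elim; auto intro: DERIV_add)+
  then show ?thesis
    using m(1-3) l(1-3)
    by (intro upper_jetI[where m = "\<lambda>t. m t + l t" and m' = "\<lambda>t. m' t + l' t"]) (auto intro: DERIV_add)
qed

lemma upper_jet_cmult:
  assumes "upper_jet \<phi> a A" "0 \<le> c"
  shows "upper_jet (\<lambda>t. c * \<phi> t) (c * a) (c * A)"
proof -
  obtain m m' where m: "m 0 = \<phi> 0" "m' 0 = a" "(m' has_real_derivative A) (at 0)"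
    "\<forall>\<^sub>F t in nhds 0. \<phi> t \<le> m t \<and> (m has_real_derivative m' t) (at t)"
    using assms(1) unfolding upper_jet_def by blast
  have "\<forall>\<^sub>F t in nhds 0. c * \<phi> t \<le> c * m t"
    and "\<forall>\<^sub>F t in nhds 0. ((\<lambda>t. c * m t) has_real_derivative c * m' t) (at t)"
    using m(4) by (eventually_elim; auto intro: DERIV_cmult mult_left_mono[OF _ assms(2)])+
  then show ?thesis
    using m(1-3) 
    by (intro upper_jetI[where m = "\<lambda>t. c * m t" and m' = "\<lambda>t. c * m' t"]) (auto intro: DERIV_cmult)
qed

lemma upper_jet_sum:
  assumes "finite I" "\<And>i. i \<in> I \<Longrightarrow> upper_jet (\<phi> i) (a i) (A i)"
  shows "upper_jet (\<lambda>t. \<Sum>i\<in>I. \<phi> i t) (\<Sum>i\<in>I. a i) (\<Sum>i\<in>I. A i)"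
  using assms
proof (induction I)
  case empty
  show ?case using upper_jet_smooth[of "\<lambda>_. 0" "\<lambda>_. 0" 0] by simp
next
  case (insert i I)
  then show ?case using upper_jet_add[of "\<phi> i" "a i" "A i"] by simp
qed

text \<open>
  Adding \<open>(B - A) t\<^sup>2 / 2\<close> keeps a majorant a majorant, so estimates of curvature can be carried out
  before the jets are added up.
\<close>
lemma upper_jet_mono:
  assumes "upper_jet \<phi> a A" "A \<le> B"
  shows "upper_jet \<phi> a B"
proof -
  obtain m m' where m: "m 0 = \<phi> 0" "m' 0 = a" "(m' has_real_derivative A) (at 0)"
    "\<forall>\<^sub>F t in nhds 0. \<phi> t \<le> m t \<and> (m has_real_derivative m' t) (at t)"
    using assms(1) unfolding upper_jet_def by blast
  have "\<forall>\<^sub>F t in nhds 0. \<phi> t \<le> m t + (B - A) / 2 * t\<^sup>2"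
    using m(4) assms(2) by (auto elim!: eventually_mono intro: add_increasing2)
  moreover have "\<forall>\<^sub>F t in nhds 0.
      ((\<lambda>t. m t + (B - A) / 2 * t\<^sup>2) has_real_derivative m' t + (B - A) * t) (at t)"
    using m(4) by eventually_elim (auto intro!: derivative_eq_intros)
  moreover have "((\<lambda>t. m' t + (B - A) * t) has_real_derivative B) (at 0)"
    using m(3) by (auto intro!: derivative_eq_intros)
  ultimately show ?thesis using m(1,2)
    by (intro upper_jetI[where m = "\<lambda>t. m t + (B - A) / 2 * t\<^sup>2"
          and m' = "\<lambda>t. m' t + (B - A) * t"]) auto
qed

lemma upper_jet_local_min:
  assumes u: "upper_jet \<phi> a A" and min: "\<forall>\<^sub>F t in nhds 0. \<phi> 0 \<le> \<phi> t"
  shows "a = 0" "0 \<le> A"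
proof -
  obtain m m' where m: "m 0 = \<phi> 0" "m' 0 = a" "(m' has_real_derivative A) (at 0)"
    "\<forall>\<^sub>F t in nhds 0. \<phi> t \<le> m t \<and> (m has_real_derivative m' t) (at t)"
    using u unfolding upper_jet_def by blast
  have "\<forall>\<^sub>F t in nhds 0. m 0 \<le> m t \<and> (m has_real_derivative m' t) (at t)"
    using m(4) min by eventually_elim (use m(1) in auto)
  then obtain e where e: "0 < e"
    "\<And>t. \<bar>t\<bar> < e \<Longrightarrow> m 0 \<le> m t \<and> (m has_real_derivative m' t) (at t)"
    unfolding eventually_nhds_metric by (auto simp: dist_real_def)
  have "(m has_real_derivative a) (at 0)" using e(2)[of 0] e(1) m(2) by simp
  then show a: "a = 0"
    by (rule DERIV_local_min[OF _ e(1)]) (use e in auto)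
  show "0 \<le> A"
  proof (rule ccontr)
    assume "\<not> 0 \<le> A"
    then obtain d where d: "0 < d" "\<And>t. 0 < t \<Longrightarrow> t < d \<Longrightarrow> m' t < m' 0"
      using DERIV_neg_dec_right[OF m(3)] by auto
    define b where "b = min d e / 2"
    have b: "0 < b" "b < d" "b < e" using d(1) e(1) by (auto simp: b_def)
    have "m 0 > m b"
    proof (rule DERIV_neg_imp_decreasing_open[OF b(1)])
      show "\<exists>y. DERIV m x :> y \<and> y < 0" if "0 < x" "x < b" for x
        using e(2)[of x] d(2)[of x] that b m(2) a by auto
      show "continuous_on {0..b} m"
        by (intro continuous_at_imp_continuous_on ballI) 
          (use e b in \<open>force intro: DERIV_isCont\<close>)
    qed
    then show False using e(2)[of b] b by auto
  qed
qed

section \<open>Upper jets of the squared distance along curves\<close>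

lemma has_real_derivative_inner:
  fixes v w :: "real \<Rightarrow> 'a::real_inner"
  assumes "(v has_vector_derivative v') (at t)" "(w has_vector_derivative w') (at t)"
  shows "((\<lambda>t. v t \<bullet> w t) has_real_derivative v t \<bullet> w' + v' \<bullet> w t) (at t)"
  unfolding has_real_derivative_iff_has_vector_derivative
  using bounded_bilinear.has_vector_derivative[OF bounded_bilinear_inner assms] .

lemma has_real_derivative_norm:
  fixes v :: "real \<Rightarrow> 'a::real_inner"
  assumes "(v has_vector_derivative v') (at t)" "v t \<noteq> 0"
  shows "((\<lambda>t. norm (v t)) has_real_derivative (v t \<bullet> v') / norm (v t)) (at t)"
proof -
  have "((\<lambda>t. sqrt (v t \<bullet> v t)) has_real_derivative
      (v t \<bullet> v' + v' \<bullet> v t) * (inverse (sqrt (v t \<bullet> v t)) / 2)) (at t)"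
    using DERIV_chain2[OF DERIV_real_sqrt has_real_derivative_inner[OF assms(1,1)]] assms(2)
    by (simp add: mult.commute)
  moreover have "(v t \<bullet> v' + v' \<bullet> v t) * (inverse (sqrt (v t \<bullet> v t)) / 2) = (v t \<bullet> v') / norm (v t)"
    by (simp add: norm_eq_sqrt_inner inner_commute field_simps)
  ultimately show ?thesis by (simp add: norm_eq_sqrt_inner)
qed

lemma upper_jet_half_sq_norm:
  fixes c :: "real \<Rightarrow> 'a::real_inner"
  assumes "\<And>t. (c has_vector_derivative c' t) (at t)" "(c' has_vector_derivative z) (at 0)"
  shows "upper_jet (\<lambda>t. (norm (c t - p))\<^sup>2 / 2) ((c 0 - p) \<bullet> c' 0) (c' 0 \<bullet> c' 0 + (c 0 - p) \<bullet> z)"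
proof (rule upper_jet_smooth)
  have d: "((\<lambda>t. c t - p) has_vector_derivative c' t) (at t)" for t
    using assms(1)[of t] by (auto intro!: derivative_eq_intros)
  show "((\<lambda>t. (norm (c t - p))\<^sup>2 / 2) has_real_derivative (c t - p) \<bullet> c' t) (at t)" for t
    unfolding power2_norm_eq_inner
    using DERIV_cdivide[OF has_real_derivative_inner[OF d d], where c = 2] by (simp add: inner_commute)
  show "((\<lambda>t. (c t - p) \<bullet> c' t) has_real_derivative c' 0 \<bullet> c' 0 + (c 0 - p) \<bullet> z) (at 0)"
    using has_real_derivative_inner[OF d assms(2)] by (simp add: add.commute)
qed

text \<open>
  Freezing the projection of \<open>c 0\<close> gives the majorant \<open>|c t - p|\<^sup>2 / 2\<close>. Its curvature contains the full
  term \<open>|c'|\<^sup>2\<close>, which is what the matrices \<open>Dg\<^sub>i\<^sup>T Dg\<^sub>i\<close> for \<open>i \<in> I\<^sub>0\<close> provide.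
\<close>
lemma upper_jet_dist_fixed_point:
  assumes "\<And>t. (c has_vector_derivative c' t) (at t)" "(c' has_vector_derivative z) (at 0)"
  shows "upper_jet (\<lambda>t. half_sq_dist J (c t)) (- (gap J (c 0) \<bullet> c' 0))
           (c' 0 \<bullet> c' 0 - gap J (c 0) \<bullet> z)"
proof -
  let ?p = "closest_point (soc J) (c 0)"
  have "upper_jet (\<lambda>t. (norm (c t - ?p))\<^sup>2 / 2) (- (gap J (c 0) \<bullet> c' 0))
           (c' 0 \<bullet> c' 0 - gap J (c 0) \<bullet> z)"
    using upper_jet_half_sq_norm[OF assms, of ?p] by (simp add: gap_def inner_diff_left algebra_simps)
  moreover have "half_sq_dist J (c t) \<le> (norm (c t - ?p))\<^sup>2 / 2" for t
    by (rule half_sq_dist_le[OF closest_in_soc])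
  moreover have "(norm (c 0 - ?p))\<^sup>2 / 2 = half_sq_dist J (c 0)"
    by (simp add: half_sq_dist_def gap_def norm_minus_commute)
  ultimately show ?thesis unfolding upper_jet_def by (smt (verit, best) eventually_mono)
qed

lemma upper_jet_dist_interior:
  assumes c: "(c has_vector_derivative c') (at 0)" "\<And>t. c t \<in> block_space J"
    and int: "norm (tail (c 0)) < c 0 $ None"
  shows "upper_jet (\<lambda>t. half_sq_dist J (c t)) 0 0"
proof -
  have "isCont c 0" using c(1) by (rule has_vector_derivative_continuous)
  then have "((\<lambda>t. c t $ None - norm (tail (c t))) \<longlongrightarrow> c 0 $ None - norm (tail (c 0))) (nhds 0)"
    by (intro tendsto_intros bounded_linear.tendsto[OF bounded_linear_tail]) (simp_all add: continuous_at tendsto_nhds_iff)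
  then have "\<forall>\<^sub>F t in nhds 0. 0 < c t $ None - norm (tail (c t))"
    using int by (intro order_tendstoD(1)) auto
  then have "\<forall>\<^sub>F t in nhds 0. half_sq_dist J (c t) = 0"
    by eventually_elim (use c(2) in \<open>auto simp: half_sq_dist_eq_0_iff soc_iff\<close>)
  then show ?thesis
    by (intro upper_jetI[where m = "\<lambda>_. 0" and m' = "\<lambda>_. 0"])
      (auto elim: eventually_mono dest: eventually_nhds_x_imp_x)
qed

text \<open>
  Here \<open>\<beta>\<close> is the derivative of \<open>|tail w| - w\<^sub>0\<close> and \<open>\<alpha>\<close> that of \<open>w\<^sub>0\<close>, so \<open>\<alpha> + \<beta>\<close> is the radial part of
  the derivative of the tail. The left side has the exact curvature, with coefficient \<open>y\<^sub>0 / n\<close>; the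
  sigma-term has \<open>y\<^sub>0 / w\<^sub>0\<close> and \<open>\<alpha>\<close> alone. The coefficients differ by \<open>O (y\<^sub>0\<^sup>2)\<close>, and the cross term
  \<open>\<alpha> \<beta>\<close> is split by Young's inequality: its \<open>\<beta>\<^sup>2\<close>-part, although large when \<open>\<epsilon>\<close> is small, is absorbed by
  the free multiplier \<open>\<gamma>\<close>, and only \<open>\<epsilon> \<alpha>\<^sup>2\<close> is charged to the perturbation of the identity.
\<close>
lemma boundary_curvature_estimate:
  fixes n w0 y0 \<alpha> \<beta> Q \<epsilon> :: real
  assumes "0 < w0" "w0 \<le> n" "0 < \<epsilon>" "y0 = (n - w0) / 2" "0 \<le> Q"
  shows "\<beta>\<^sup>2 / 2 + y0 / n * (Q - (\<alpha> + \<beta>)\<^sup>2) \<le>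
     - (y0 / w0) * (\<alpha>\<^sup>2 - Q) + (1/2 + (y0 / n)\<^sup>2 / \<epsilon>) * \<beta>\<^sup>2
     + (2 * y0\<^sup>2 / w0\<^sup>2 + \<epsilon>) * (\<alpha>\<^sup>2 + Q)"
proof -
  define a where "a = y0 / n"
  define b where "b = y0 / w0"
  have n: "0 < n" using assms by linarith
  have y0: "0 \<le> y0" using assms by simp
  have a: "0 \<le> a" "a \<le> b"
    unfolding a_def b_def using y0 assms n by (auto intro: divide_left_mono)
  have nw: "n - w0 = 2 * y0" using assms by simp
  have "b - a = y0 * (n - w0) / (w0 * n)" using n assms(1) by (simp add: a_def b_def field_simps)
  also have "\<dots> = 2 * y0\<^sup>2 / (w0 * n)" unfolding nw by (simp add: power2_eq_square)
  also have "\<dots> \<le> 2 * y0\<^sup>2 / w0\<^sup>2"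
    using assms n by (intro divide_left_mono) (auto simp: power2_eq_square intro: mult_left_mono)
  finally have ba: "b - a \<le> 2 * y0\<^sup>2 / w0\<^sup>2" .
  have cross: "- (2 * a * \<alpha> * \<beta>) \<le> \<epsilon> * \<alpha>\<^sup>2 + a\<^sup>2 / \<epsilon> * \<beta>\<^sup>2"
  proof -
    have "0 \<le> (\<epsilon> * \<alpha> + a * \<beta>)\<^sup>2 / \<epsilon>" using assms(3) by simp
    also have "\<dots> = \<epsilon> * \<alpha>\<^sup>2 + a\<^sup>2 / \<epsilon> * \<beta>\<^sup>2 + 2 * a * \<alpha> * \<beta>"
      using assms(3) by (simp add: power2_eq_square field_simps)
    finally show ?thesis by linarith
  qed
  have "\<beta>\<^sup>2 / 2 + a * (Q - (\<alpha> + \<beta>)\<^sup>2)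
      = \<beta>\<^sup>2 / 2 + a * Q - a * \<alpha>\<^sup>2 - a * \<beta>\<^sup>2 - 2 * a * \<alpha> * \<beta>"
    by (simp add: power2_eq_square algebra_simps)
  also have "\<dots> \<le> \<beta>\<^sup>2 / 2 + b * Q - a * \<alpha>\<^sup>2 + (\<epsilon> * \<alpha>\<^sup>2 + a\<^sup>2 / \<epsilon> * \<beta>\<^sup>2)"
    using cross mult_right_mono[OF a(2) assms(5)] mult_nonneg_nonneg[OF a(1), of "\<beta>\<^sup>2"] by simp
  also have "\<dots> = - b * (\<alpha>\<^sup>2 - Q) + (1/2 + a\<^sup>2 / \<epsilon>) * \<beta>\<^sup>2 + ((b - a) + \<epsilon>) * \<alpha>\<^sup>2"
    by (simp add: algebra_simps)
  also have "\<dots> \<le> - b * (\<alpha>\<^sup>2 - Q) + (1/2 + a\<^sup>2 / \<epsilon>) * \<beta>\<^sup>2 + (2 * y0\<^sup>2 / w0\<^sup>2 + \<epsilon>) * (\<alpha>\<^sup>2 + Q)"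
    using ba a assms(1,3,5) by (intro add_left_mono mult_mono) auto
  finally show ?thesis unfolding a_def b_def .
qed

text \<open>
  The constant \<open>C\<close> depends on the point \<open>w\<close> but not on the curve: a single \<open>\<gamma>\<close> has to serve all
  directions \<open>d\<close>. The square it multiplies is that of \<open>\<langle>\<Gamma> w~, c'\<rangle>\<close> with \<open>w~ = (|tail w|, tail w)\<close>, and the
  last coefficient is small even after multiplication by \<open>\<rho>\<close>, as long as \<open>\<rho> |gap|\<^sup>2\<close> and \<open>\<rho> \<epsilon>\<close> are
  small and \<open>w\<^sub>0\<close> stays away from \<open>0\<close>.
\<close>
lemma upper_jet_dist_boundary:
  assumes w: "w \<in> block_space J" and w0: "0 < w $ None" and \<epsilon>: "0 < \<epsilon>"
  shows "\<exists>C. \<forall>c c' z. (\<forall>t. c t \<in> block_space J) \<longrightarrow> c 0 = w \<longrightarrow>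
     (\<forall>t. (c has_vector_derivative c' t) (at t)) \<longrightarrow> (c' has_vector_derivative z) (at 0) \<longrightarrow>
     upper_jet (\<lambda>t. half_sq_dist J (c t)) (- (gap J w \<bullet> c' 0))
       (- (gap J w \<bullet> z)
        - (gap J w $ None / w $ None) * ((c' 0 $ None)\<^sup>2 - (norm (tail (c' 0)))\<^sup>2)
        + C * (norm (tail w) * c' 0 $ None - tail w \<bullet> tail (c' 0))\<^sup>2
        + ((norm (gap J w))\<^sup>2 / (w $ None)\<^sup>2 + \<epsilon>) * (norm (c' 0))\<^sup>2)"
proof (cases "norm (tail w) < w $ None")
  case True
  then have g: "gap J w = 0" using w by (simp add: gap_eq_0_iff soc_iff)
  show ?thesis
    by (rule exI[of _ 0]) (use True g \<epsilon> in \<open>auto intro!: upper_jet_mono[OF upper_jet_dist_interior]\<close>)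
next
  case False
  define n where "n = norm (tail w)"
  have n: "w $ None \<le> n" "0 < n" using False w0 by (auto simp: n_def)
  define y0 where "y0 = (n - w $ None) / 2"
  have gw: "gap J w = blk y0 (- (y0 / n) *\<^sub>R tail w)"
    and hw: "half_sq_dist J w = (n - w $ None)\<^sup>2 / 4"
    using gap_outside[OF w w0] n by (simp_all add: n_def y0_def)
  have ng: "(norm (gap J w))\<^sup>2 = 2 * y0\<^sup>2"
    using n by (simp add: gw norm_block_sq power_mult_distrib power_divide flip: n_def)
  \<comment> \<open>the square multiplied by \<open>C\<close> is \<open>n\<^sup>2 \<beta>\<^sup>2\<close> with \<open>\<beta> = s' 0\<close>, which explains the division by \<open>n\<^sup>2\<close>\<close>
  show ?thesis
  proof (rule exI[of _ "(1/2 + (y0 / n)\<^sup>2 / \<epsilon>) / n\<^sup>2"], intro allI impI)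
    fix c c' :: "real \<Rightarrow> 'a blk" and z
    assume c: "\<forall>t. c t \<in> block_space J" "c 0 = w"
      "\<forall>t. (c has_vector_derivative c' t) (at t)" "(c' has_vector_derivative z) (at 0)"
    define v where "v t = tail (c t)" for t
    define v' where "v' t = tail (c' t)" for t
    have v: "(v has_vector_derivative v' t) (at t)" "(v' has_vector_derivative tail z) (at 0)" for t
      unfolding v_def v'_def using c(3,4) bounded_linear.has_vector_derivative[OF bounded_linear_tail]
      by blast+
    have r: "((\<lambda>t. c t $ None) has_real_derivative c' t $ None) (at t)"
      "((\<lambda>t. c' t $ None) has_real_derivative z $ None) (at 0)" for t
      unfolding has_real_derivative_iff_has_vector_derivative
      using c(3,4) bounded_linear.has_vector_derivative[OF bounded_linear_vec_nth] by blast+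
    have v0: "v 0 = tail w" "norm (v 0) = n" using c(2) by (simp_all add: v_def n_def)
    have ev: "\<forall>\<^sub>F t in nhds 0. v t \<noteq> 0 \<and> 0 < c t $ None"
    proof -
      have "isCont v 0" using v(1) by (rule has_vector_derivative_continuous)
      moreover have "isCont (\<lambda>t. c t $ None) 0" using r(1) by (rule DERIV_isCont)
      ultimately have "(v \<longlongrightarrow> v 0) (nhds 0)" "((\<lambda>t. c t $ None) \<longlongrightarrow> w $ None) (nhds 0)"
        using c(2) by (auto simp: continuous_at tendsto_nhds_iff)
      then show ?thesis
        using tendsto_imp_eventually_ne[of v "v 0" "nhds 0" 0] order_tendstoD(1)[OF _ w0] v0 n
        by (auto intro!: eventually_conj)
    qed
    define s where "s t = norm (v t) - c t $ None" for t
    define s' where "s' t = (v t \<bullet> v' t) / norm (v t) - c' t $ None" for t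
    have ds: "(s has_real_derivative s' t) (at t)" if "v t \<noteq> 0" for t
      unfolding s_def s'_def by (intro derivative_intros has_real_derivative_norm v that r)
    define q where "q = v 0 \<bullet> v' 0"
    define Q where "Q = (norm (v' 0))\<^sup>2"
    define s'' where "s'' = (Q + v 0 \<bullet> tail z) / n - q\<^sup>2 / n ^ 3 - z $ None"
    have ds': "(s' has_real_derivative s'') (at 0)"
    proof -
      have "((\<lambda>t. (v t \<bullet> v' t) / norm (v t) - c' t $ None) has_real_derivative
         ((v 0 \<bullet> tail z + v' 0 \<bullet> v' 0) * norm (v 0) - (v 0 \<bullet> v' 0) * ((v 0 \<bullet> v' 0) / norm (v 0)))
           / (norm (v 0) * norm (v 0)) - z $ None) (at 0)"
        using n v0 by (intro DERIV_diff DERIV_divide has_real_derivative_inner has_real_derivative_norm v r) auto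
      also have "((v 0 \<bullet> tail z + v' 0 \<bullet> v' 0) * norm (v 0) - (v 0 \<bullet> v' 0) * ((v 0 \<bullet> v' 0) / norm (v 0)))
           / (norm (v 0) * norm (v 0)) - z $ None = s''"
        unfolding s''_def Q_def q_def power2_norm_eq_inner v0(2)
        using n by (simp add: field_simps power2_eq_square power3_eq_cube)
      finally show ?thesis unfolding s'_def .
    qed
    have s0: "s 0 = 2 * y0" using c(2) by (simp add: s_def v0(2) y0_def)
    have "upper_jet (\<lambda>t. half_sq_dist J (c t)) (y0 * s' 0) ((s' 0)\<^sup>2 / 2 + y0 * s'')"
    proof (rule upper_jetI[where m = "\<lambda>t. (s t)\<^sup>2 / 4" and m' = "\<lambda>t. s t * s' t / 2"])
      show "(s 0)\<^sup>2 / 4 = half_sq_dist J (c 0)" by (simp add: c(2) hw s_def v0(2))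
      show "\<forall>\<^sub>F t in nhds 0. half_sq_dist J (c t) \<le> (s t)\<^sup>2 / 4"
        using ev by eventually_elim
          (use c(1) half_sq_dist_le_tail_excess in \<open>auto simp: s_def v_def\<close>)
      show "\<forall>\<^sub>F t in nhds 0. ((\<lambda>t. (s t)\<^sup>2 / 4) has_real_derivative s t * s' t / 2) (at t)"
        using ev by eventually_elim (auto intro!: derivative_eq_intros ds)
      show "s 0 * s' 0 / 2 = y0 * s' 0" by (simp add: s0)
      have "(s has_real_derivative s' 0) (at 0)" using ds[of 0] v0 n by auto
      then show "((\<lambda>t. s t * s' t / 2) has_real_derivative (s' 0)\<^sup>2 / 2 + y0 * s'') (at 0)"
        using ds' by (auto intro!: derivative_eq_intros simp: s0 power2_eq_square field_simps)
    qed
    moreover have "y0 * s' 0 = - (gap J w \<bullet> c' 0)"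
      by (simp add: gw inner_block s'_def v0 v'_def n_def algebra_simps)
    moreover have "(s' 0)\<^sup>2 / 2 + y0 * s'' \<le> - (gap J w \<bullet> z)
        - (gap J w $ None / w $ None) * ((c' 0 $ None)\<^sup>2 - (norm (tail (c' 0)))\<^sup>2)
        + (1/2 + (y0 / n)\<^sup>2 / \<epsilon>) / n\<^sup>2 * (norm (tail w) * c' 0 $ None - tail w \<bullet> tail (c' 0))\<^sup>2
        + ((norm (gap J w))\<^sup>2 / (w $ None)\<^sup>2 + \<epsilon>) * (norm (c' 0))\<^sup>2"
    proof -
      let ?\<alpha> = "c' 0 $ None" and ?\<beta> = "s' 0"
      have q: "q = n * (?\<alpha> + ?\<beta>)" using n by (simp add: s'_def q_def v0(2))
      have "y0 * s'' = - (gap J w \<bullet> z) + y0 / n * (Q - (?\<alpha> + ?\<beta>)\<^sup>2)"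
        using n by (simp add: s''_def q gw inner_block v0(1) field_simps power2_eq_square power3_eq_cube)
      moreover have "norm (tail w) * c' 0 $ None - tail w \<bullet> tail (c' 0) = - (n * ?\<beta>)"
        using q by (simp add: q_def v0(1) v'_def n_def algebra_simps)
      then have "(1/2 + (y0 / n)\<^sup>2 / \<epsilon>) / n\<^sup>2 * (norm (tail w) * c' 0 $ None - tail w \<bullet> tail (c' 0))\<^sup>2
          = (1/2 + (y0 / n)\<^sup>2 / \<epsilon>) * ?\<beta>\<^sup>2"
        using n by (simp add: power_mult_distrib)
      moreover have "(norm (c' 0))\<^sup>2 = ?\<alpha>\<^sup>2 + Q" by (simp add: norm_block_sq Q_def v'_def)
      moreover have "(norm (tail (c' 0)))\<^sup>2 = Q" by (simp add: Q_def v'_def)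
      moreover have "gap J w $ None = y0" by (simp add: gw)
      ultimately show ?thesis
        using boundary_curvature_estimate[OF w0 n(1) \<epsilon> y0_def, of Q ?\<beta> ?\<alpha>]
        by (simp add: ng Q_def)
    qed
    ultimately show "upper_jet (\<lambda>t. half_sq_dist J (c t)) (- (gap J w \<bullet> c' 0))
       (- (gap J w \<bullet> z)
        - (gap J w $ None / w $ None) * ((c' 0 $ None)\<^sup>2 - (norm (tail (c' 0)))\<^sup>2)
        + (1/2 + (y0 / n)\<^sup>2 / \<epsilon>) / n\<^sup>2 * (norm (tail w) * c' 0 $ None - tail w \<bullet> tail (c' 0))\<^sup>2
        + ((norm (gap J w))\<^sup>2 / (w $ None)\<^sup>2 + \<epsilon>) * (norm (c' 0))\<^sup>2)"
      using upper_jet_mono by simp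
  qed
qed

section \<open>Minimizers of the penalty functions\<close>

text \<open>
  The convergence of \<open>\<rho> V\<close> to \<open>0\<close> comes from \<open>0 \<le> \<rho> V (x) \<le> G (x0) - G (x)\<close> once \<open>x\<close> tends to \<open>x0\<close>.
\<close>
lemma penalty_minimizers:
  fixes G V :: "'a::heine_borel \<Rightarrow> real"
  assumes B: "compact B" and cont: "continuous_on B G" "continuous_on B V"
    and V: "\<And>y. y \<in> B \<Longrightarrow> 0 \<le> V y" and x0: "x0 \<in> B" "V x0 = 0"
    and strict: "\<And>y. y \<in> B \<Longrightarrow> V y = 0 \<Longrightarrow> G y \<le> G x0 \<Longrightarrow> y = x0"
    and \<rho>: "filterlim \<rho> at_top sequentially" "\<And>k::nat. 0 < (\<rho> k :: real)"
  obtains x where "\<forall>k. \<forall>y\<in>B. G (x k) + \<rho> k * V (x k) \<le> G y + \<rho> k * V y"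
    and "x \<longlonglongrightarrow> x0" and "(\<lambda>k. \<rho> k * V (x k)) \<longlonglongrightarrow> 0"
proof -
  have "\<exists>x\<in>B. \<forall>y\<in>B. G x + \<rho> k * V x \<le> G y + \<rho> k * V y" for k
    using B x0(1) by (intro continuous_attains_inf continuous_intros cont) auto
  then obtain x where xB: "\<And>k. x k \<in> B"
    and min: "\<And>k y. y \<in> B \<Longrightarrow> G (x k) + \<rho> k * V (x k) \<le> G y + \<rho> k * V y"
    by metis
  have nonneg: "0 \<le> \<rho> k * V (x k)" for k
    using V[OF xB, of k] \<rho>(2)[of k] by simp
  have le: "G (x k) + \<rho> k * V (x k) \<le> G x0" for k
    using min[OF x0(1), of k] x0(2) by simp
  have Gle: "G (x k) \<le> G x0" for k
    using le[of k] nonneg[of k] by linarith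
  obtain b where b: "\<And>y. y \<in> B \<Longrightarrow> b \<le> G y"
    using continuous_attains_inf[OF B _ cont(1)] x0(1) by (metis empty_iff)
  have V0: "(\<lambda>k. V (x k)) \<longlonglongrightarrow> 0"
  proof (rule real_tendsto_sandwich[of "\<lambda>_. 0" _ _ "\<lambda>k. (G x0 - b) / \<rho> k"])
    show "\<forall>\<^sub>F k in sequentially. V (x k) \<le> (G x0 - b) / \<rho> k"
      using le b[OF xB] \<rho>(2) by (intro always_eventually allI) (smt (verit) mult.commute pos_le_divide_eq)
    show "(\<lambda>k. (G x0 - b) / \<rho> k) \<longlonglongrightarrow> 0"
      by (rule real_tendsto_divide_at_top[OF tendsto_const \<rho>(1)])
  qed (use V[OF xB] in auto)
  have lim: "x \<longlonglongrightarrow> x0"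
  proof (rule ccontr)
    assume "\<not> x \<longlonglongrightarrow> x0"
    then obtain e where e: "0 < e" "\<exists>\<^sub>F k in sequentially. e \<le> dist (x k) x0"
      unfolding tendsto_iff by (auto simp: not_eventually not_less)
    then obtain r :: "nat \<Rightarrow> nat" where r: "strict_mono r" "\<And>k. e \<le> dist (x (r k)) x0"
      using infinite_enumerate[of "{k. e \<le> dist (x k) x0}"]
      by (auto simp: frequently_cofinite cofinite_eq_sequentially[symmetric])
    obtain l r' where l: "l \<in> B" "strict_mono r'" "((x \<circ> r) \<circ> r') \<longlonglongrightarrow> l"
      using B xB unfolding compact_def by (metis comp_apply)
    have sub: "strict_mono (r \<circ> r')" using r(1) l(2) by (rule strict_mono_o)
    have xl: "(\<lambda>k. x ((r \<circ> r') k)) \<longlonglongrightarrow> l" using l(3) by (simp add: o_def)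
    have Vl: "(\<lambda>k. V (x ((r \<circ> r') k))) \<longlonglongrightarrow> V l" and Gl: "(\<lambda>k. G (x ((r \<circ> r') k))) \<longlonglongrightarrow> G l"
      using continuous_on_tendsto_compose[OF cont(2) xl l(1)]
        continuous_on_tendsto_compose[OF cont(1) xl l(1)] xB by auto
    have "(\<lambda>k. V (x ((r \<circ> r') k))) \<longlonglongrightarrow> 0"
      using LIMSEQ_subseq_LIMSEQ[OF V0 sub] by (simp add: o_def)
    with Vl have "V l = 0" by (rule LIMSEQ_unique)
    moreover have "G l \<le> G x0"
      by (rule LIMSEQ_le_const2[OF Gl]) (use Gle in auto)
    ultimately have "l = x0" using strict l(1) by blast
    moreover have "e \<le> dist l x0"
      using tendsto_dist[OF xl tendsto_const, of x0] by (rule LIMSEQ_le_const) (use r in auto)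
    ultimately show False using e(1) by simp
  qed
  have "(\<lambda>k. G (x k)) \<longlonglongrightarrow> G x0"
    using continuous_on_tendsto_compose[OF cont(1) lim x0(1)] xB by auto
  then have *: "(\<lambda>k. G x0 - G (x k)) \<longlonglongrightarrow> 0"
    using tendsto_diff[OF tendsto_const, of _ "G x0" _ "G x0"] by fastforce
  have "\<rho> k * V (x k) \<le> G x0 - G (x k)" for k using le[of k] by linarith
  then have "(\<lambda>k. \<rho> k * V (x k)) \<longlonglongrightarrow> 0"
    using nonneg by (intro real_tendsto_sandwich[OF _ _ tendsto_const *]) auto
  with min lim that show thesis by blast
qed

section \<open>Gradient, Hessian and the CAKKT2 matrix\<close>

lemma inner_grad:
  fixes F :: "'a::euclidean_space \<Rightarrow> real"
  assumes "(F has_derivative F') (at x)"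
  shows "grad F x \<bullet> d = F' d"
proof -
  interpret bounded_linear F' using assms by (rule has_derivative_bounded_linear)
  define D where "D = (\<Sum>b\<in>Basis. F' b *\<^sub>R b)"
  have D: "h \<bullet> D = F' h" for h
  proof -
    have "h \<bullet> D = (\<Sum>b\<in>Basis. F' ((h \<bullet> b) *\<^sub>R b))"
      by (simp add: D_def inner_sum_right scaleR mult.commute)
    also have "\<dots> = F' h" by (simp add: sum[symmetric] euclidean_representation)
    finally show ?thesis .
  qed
  have "grad F x = D" unfolding grad_def
  proof (rule the_equality)
    show "GDERIV F x :> D" using assms by (simp add: gderiv_def D)
    show "E = D" if "GDERIV F x :> E" for E
    proof -
      have "(\<lambda>h. h \<bullet> E) = F'"
        using that assms unfolding gderiv_def by (rule has_derivative_unique)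
      then have "(E - D) \<bullet> E = (E - D) \<bullet> D" using D[of "E - D"] by metis
      then have "(E - D) \<bullet> (E - D) = 0" by (simp add: inner_diff_right)
      then show ?thesis by simp
    qed
  qed
  then show ?thesis using D[of d] by (simp add: inner_commute)
qed

lemma inner_hessian:
  fixes F :: "real^'n \<Rightarrow> real" and F' :: "real^'n \<Rightarrow> (real^'n) \<Rightarrow>\<^sub>L real"
  assumes F': "\<And>y. (F has_derivative blinfun_apply (F' y)) (at y)"
    and F'': "(F' has_derivative F'') (at x)"
  shows "d \<bullet> (hessian F x *v e) = F'' e d"
proof -
  have grad: "grad F = (\<lambda>y. \<Sum>b\<in>Basis. F' y b *\<^sub>R b)"
  proof
    fix y
    have "grad F y = (\<Sum>b\<in>Basis. (grad F y \<bullet> b) *\<^sub>R b)"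
      by (rule euclidean_representation[symmetric])
    then show "grad F y = (\<Sum>b\<in>Basis. F' y b *\<^sub>R b)" using inner_grad[OF F'] by simp
  qed
  have "((\<lambda>y. blinfun_apply (F' y) b) has_derivative (\<lambda>e. blinfun_apply (F'' e) b)) (at x)" for b
    by (rule bounded_linear.has_derivative
        [OF bounded_bilinear.bounded_linear_left[OF bounded_bilinear_blinfun_apply] F''])
  then have *: "(grad F has_derivative (\<lambda>e. \<Sum>b\<in>Basis. F'' e b *\<^sub>R b)) (at x)"
    unfolding grad by (intro has_derivative_sum has_derivative_scaleR_left)
  then have "(grad F has_derivative (\<lambda>e. jacobian (grad F) (at x) *v e)) (at x)"
    using jacobian_works differentiableI by blast
  then have "(\<lambda>e. jacobian (grad F) (at x) *v e) = (\<lambda>e. \<Sum>b\<in>Basis. F'' e b *\<^sub>R b)"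
    by (rule has_derivative_unique[OF _ *])
  then have "hessian F x *v e = (\<Sum>b\<in>Basis. F'' e b *\<^sub>R b)"
    unfolding hessian_def by (rule fun_cong)
  then have "d \<bullet> (hessian F x *v e) = (\<Sum>b\<in>Basis. blinfun_apply (F'' e) ((d \<bullet> b) *\<^sub>R b))"
    by (simp only: inner_sum_right inner_scaleR_right blinfun.scaleR_right real_scaleR_def mult.commute)
  also have "\<dots> = blinfun_apply (F'' e) (\<Sum>b\<in>Basis. (d \<bullet> b) *\<^sub>R b)"
    by (rule blinfun.sum_right[symmetric])
  also have "\<dots> = F'' e d" by (simp only: euclidean_representation)
  finally show ?thesis .
qed

lemma Gamma_mat_mult: "Gamma_mat *v u = blk (u $ None) (- tail u)"
proof -
  have "(Gamma_mat *v u) $ a = (if a = None then 1 else - 1) * u $ a" for a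
  proof -
    have "(Gamma_mat *v u) $ a = (\<Sum>b\<in>UNIV. if a = b then (if a = None then 1 else - 1) * u $ b else 0)"
      unfolding matrix_vector_mult_def Gamma_mat_def vec_lambda_beta by (rule sum.cong) auto
    then show ?thesis by simp
  qed
  then show ?thesis by (intro block_eqI) (auto simp: tail_def vec_eq_iff)
qed

lemma outer_mult: "outer v w *v d = (w \<bullet> d) *\<^sub>R v"
  by (simp add: outer_def matrix_vector_mult_def vec_eq_iff inner_vec_def sum_distrib_left mult_ac)

lemma sum_matrix_vector_mult:
  fixes A :: "'i \<Rightarrow> real^'n^'m"
  shows "(\<Sum>i\<in>I. A i) *v d = (\<Sum>i\<in>I. A i *v d)"
  by (induction I rule: infinite_finite_induct) (auto simp: matrix_vector_mult_add_rdistrib)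

lemma inner_transpose_mult:
  fixes A :: "real^'n^'m"
  shows "d \<bullet> (transpose A *v v) = (A *v d) \<bullet> v"
  by (metis dot_lmul_matrix inner_commute transpose_matrix_vector)

text \<open>
  The blocks of \<open>g\<close> enter the added matrices only through the derivatives \<open>u i = Dg\<^sub>i d\<close> along \<open>d\<close>, so
  comparing matrices reduces to comparing curvatures along lines.
\<close>
lemma CAKKT2_quadratic_form:
  fixes g :: "real^'n \<Rightarrow> ('m::finite) blk^('r::finite)" and x d :: "real^'n"
  defines "u \<equiv> \<lambda>i. Dg g i x *v d"
  shows "d \<bullet> (CAKKT2_mat J f g h xstar x \<mu> \<omega> \<eta> \<theta> \<gamma> \<delta> *v d) =
     d \<bullet> (hessian (\<lambda>y. lagrangian f g h y \<mu> \<omega>) x *v d)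
     - (\<Sum>i\<in>IB J g xstar. \<omega> $ i $ None / g x $ i $ None * ((u i $ None)\<^sup>2 - (norm (tail (u i)))\<^sup>2))
     + (\<Sum>i\<in>UNIV. \<eta> $ i * (grad (\<lambda>y. h y $ i) x \<bullet> d)\<^sup>2)
     + (\<Sum>i\<in>IB J g xstar. \<gamma> i *
          (norm (tail (g x $ i)) * u i $ None - tail (g x $ i) \<bullet> tail (u i))\<^sup>2)
     + (\<Sum>i\<in>I0 g xstar. \<theta> i * (norm (u i))\<^sup>2)
     + \<delta> * (norm d)\<^sup>2"
proof -
  have u: "Dg g i x *v d = u i" for i by (simp add: u_def)
  have sig: "d \<bullet> ((transpose (Dg g i x) ** Gamma_mat ** Dg g i x) *v d)
      = (u i $ None)\<^sup>2 - (norm (tail (u i)))\<^sup>2" for i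
    by (simp only: matrix_vector_mul_assoc[symmetric] inner_transpose_mult Gamma_mat_mult u)
      (simp add: inner_block power2_eq_square flip: power2_norm_eq_inner)
  have gam: "d \<bullet> ((transpose (Dg g i x) ** Gamma_mat) *v g_tilde g i x)
      = norm (tail (g x $ i)) * u i $ None - tail (g x $ i) \<bullet> tail (u i)" for i
    by (simp only: matrix_vector_mul_assoc[symmetric] inner_transpose_mult Gamma_mat_mult u)
      (simp add: inner_block g_tilde_def inner_commute)
  have the: "d \<bullet> ((transpose (Dg g i x) ** Dg g i x) *v d) = (norm (u i))\<^sup>2" for i
    by (simp only: matrix_vector_mul_assoc[symmetric] inner_transpose_mult u power2_norm_eq_inner)
  have out: "d \<bullet> (outer v v *v d) = (d \<bullet> v)\<^sup>2" for v
    by (simp add: outer_mult inner_commute power2_eq_square)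
  have sc: "d \<bullet> ((c *\<^sub>R A) *v d) = c * (d \<bullet> (A *v d))" for c and A :: "real^'n^'n"
    by (simp flip: scaleR_matrix_vector_assoc)
  show ?thesis
    unfolding CAKKT2_mat_def sigma_mat_def
    by (simp only: matrix_vector_mult_add_rdistrib sum_matrix_vector_mult inner_add_right
        inner_sum_right sc sig gam the out matrix_vector_mul_lid)
      (simp add: sum_negf inner_commute power2_norm_eq_inner)
qed

lemma lagrangian_derivatives:
  fixes f :: "real^'n \<Rightarrow> real" and g :: "real^'n \<Rightarrow> ('m::finite) blk^('r::finite)"
    and h :: "real^'n \<Rightarrow> real^'p"
  assumes f: "\<And>y. (f has_derivative blinfun_apply (f' y)) (at y)"
      "\<And>y. (f' has_derivative blinfun_apply (f'' y)) (at y)"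
    and g: "\<And>y. (g has_derivative blinfun_apply (g' y)) (at y)"
      "\<And>y. (g' has_derivative blinfun_apply (g'' y)) (at y)"
    and h: "\<And>y. (h has_derivative blinfun_apply (h' y)) (at y)"
      "\<And>y. (h' has_derivative blinfun_apply (h'' y)) (at y)"
  shows "grad (\<lambda>y. lagrangian f g h y \<mu> \<omega>) x \<bullet> d = f' x d + \<mu> \<bullet> h' x d - \<omega> \<bullet> g' x d"
    and "d \<bullet> (hessian (\<lambda>y. lagrangian f g h y \<mu> \<omega>) x *v d)
      = f'' x d d + \<mu> \<bullet> h'' x d d - \<omega> \<bullet> g'' x d d"
proof -
  define L' where "L' y = f' y + (blinfun_inner_right \<mu> o\<^sub>L h' y) - (blinfun_inner_right \<omega> o\<^sub>L g' y)" for y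
  have L': "((\<lambda>y. lagrangian f g h y \<mu> \<omega>) has_derivative blinfun_apply (L' y)) (at y)" for y
    unfolding lagrangian_def L'_def
    by (auto intro!: derivative_eq_intros f g h simp: blinfun.bilinear_simps inner_commute)
  have L'': "(L' has_derivative (\<lambda>e. f'' x e + (blinfun_inner_right \<mu> o\<^sub>L h'' x e)
      - (blinfun_inner_right \<omega> o\<^sub>L g'' x e))) (at x)"
    unfolding L'_def
    by (intro has_derivative_add has_derivative_diff f bounded_linear.has_derivative
        [OF bounded_bilinear.bounded_linear_right[OF bounded_bilinear_blinfun_compose]] g h)
  show "grad (\<lambda>y. lagrangian f g h y \<mu> \<omega>) x \<bullet> d = f' x d + \<mu> \<bullet> h' x d - \<omega> \<bullet> g' x d"
    using inner_grad[OF L'] by (simp add: L'_def blinfun.bilinear_simps)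
  show "d \<bullet> (hessian (\<lambda>y. lagrangian f g h y \<mu> \<omega>) x *v d)
      = f'' x d d + \<mu> \<bullet> h'' x d d - \<omega> \<bullet> g'' x d d"
    using inner_hessian[OF L' L''] by (simp add: blinfun.bilinear_simps)
qed

section \<open>Stationarity of the penalty minimizers\<close>

lemma line_derivatives:
  fixes F :: "'a::real_normed_vector \<Rightarrow> 'b::real_normed_vector"
  assumes "\<And>y. (F has_derivative blinfun_apply (F' y)) (at y)"
    and "\<And>y. (F' has_derivative blinfun_apply (F'' y)) (at y)"
  shows "((\<lambda>t. F (x + t *\<^sub>R d)) has_vector_derivative F' (x + t *\<^sub>R d) d) (at t)"
    and "((\<lambda>t. blinfun_apply (F' (x + t *\<^sub>R d)) d) has_vector_derivative F'' x d d) (at 0)"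
proof -
  have l: "((\<lambda>t. x + t *\<^sub>R d) has_derivative (\<lambda>t. t *\<^sub>R d)) (at t)" for t
    by (auto intro!: derivative_eq_intros)
  show "((\<lambda>t. F (x + t *\<^sub>R d)) has_vector_derivative F' (x + t *\<^sub>R d) d) (at t)"
    unfolding has_vector_derivative_def
    using has_derivative_compose[OF l assms(1)] by (simp add: blinfun.bilinear_simps)
  have "((\<lambda>y. blinfun_apply (F' y) d) has_derivative (\<lambda>e. F'' y e d)) (at y)" for y
    by (rule bounded_linear.has_derivative
        [OF bounded_bilinear.bounded_linear_left[OF bounded_bilinear_blinfun_apply] assms(2)])
  from has_derivative_compose[OF l this, of 0]
  show "((\<lambda>t. blinfun_apply (F' (x + t *\<^sub>R d)) d) has_vector_derivative F'' x d d) (at 0)"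
    unfolding has_vector_derivative_def by (simp add: blinfun.bilinear_simps)
qed

lemma upper_jet_quartic:
  fixes a d :: "'a::real_inner"
  shows "upper_jet (\<lambda>t. 1/4 * norm (a + t *\<^sub>R d) ^ 4) ((norm a)\<^sup>2 * (a \<bullet> d)) (3 * (norm a)\<^sup>2 * (norm d)\<^sup>2)"
proof -
  define v where "v t = a + t *\<^sub>R d" for t
  have v: "(v has_vector_derivative d) (at t)" for t
    unfolding v_def by (auto intro!: derivative_eq_intros)
  have i: "((\<lambda>t. v t \<bullet> v t) has_real_derivative 2 * (v t \<bullet> d)) (at t)"
    "((\<lambda>t. v t \<bullet> d) has_real_derivative d \<bullet> d) (at t)" for t
    using has_real_derivative_inner[OF v[of t] v[of t]]
      has_real_derivative_inner[OF v[of t] has_vector_derivative_const[where c = d]]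
    by (simp_all add: inner_commute)
  have "upper_jet (\<lambda>t. (v t \<bullet> v t)\<^sup>2 / 4) ((v 0 \<bullet> v 0) * (v 0 \<bullet> d))
      (2 * (v 0 \<bullet> d) * (v 0 \<bullet> d) + (d \<bullet> d) * (v 0 \<bullet> v 0))"
    by (rule upper_jet_smooth) (auto intro!: derivative_eq_intros i)
  moreover have "(v t \<bullet> v t)\<^sup>2 / 4 = 1/4 * norm (a + t *\<^sub>R d) ^ 4" for t
    by (simp add: v_def power2_norm_eq_inner[symmetric])
  moreover have "2 * (v 0 \<bullet> d) * (v 0 \<bullet> d) + (d \<bullet> d) * (v 0 \<bullet> v 0) \<le> 3 * (norm a)\<^sup>2 * (norm d)\<^sup>2"
    using Cauchy_Schwarz_ineq[of a d]
    by (simp add: v_def power2_norm_eq_inner power2_eq_square[symmetric] mult.commute)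
  ultimately show ?thesis
    using upper_jet_mono by (simp add: v_def power2_norm_eq_inner)
qed

text \<open>
  Restricting the penalty function to each line through its minimizer \<open>x\<close>, the jets of the summands
  add up to the Lagrangian with multipliers \<open>\<mu>\<close> and \<open>\<omega>\<close>, plus curvature terms of the shape required by
  CAKKT2. The summand \<open>1 / \<rho>\<close> of \<open>\<delta>\<close> is \<open>\<rho> \<epsilon>\<close> for the
  splitting parameter \<open>\<epsilon> = 1 / \<rho>\<^sup>2\<close>: small enough to vanish after scaling by \<open>\<rho>\<close>.
\<close>
lemma penalty_stationarity:
  fixes J :: "'r::finite \<Rightarrow> 'm::finite set" and f :: "real^'n \<Rightarrow> real"
    and g :: "real^'n \<Rightarrow> 'm blk^'r" and h :: "real^'n \<Rightarrow> real^'p" and xstar x :: "real^'n"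
  assumes f: "\<And>y. (f has_derivative blinfun_apply (f' y)) (at y)"
      "\<And>y. (f' has_derivative blinfun_apply (f'' y)) (at y)"
    and g: "\<And>y. (g has_derivative blinfun_apply (g' y)) (at y)"
      "\<And>y. (g' has_derivative blinfun_apply (g'' y)) (at y)"
    and h: "\<And>y. (h has_derivative blinfun_apply (h' y)) (at y)"
      "\<And>y. (h' has_derivative blinfun_apply (h'' y)) (at y)"
    and blk: "\<And>y i. g y $ i \<in> block_space (J i)"
    and IB: "\<And>i. i \<in> IB J g xstar \<Longrightarrow> 0 < g x $ i $ None"
    and int: "\<And>i. i \<notin> I0 g xstar \<Longrightarrow> i \<notin> IB J g xstar \<Longrightarrow> norm (tail (g x $ i)) < g x $ i $ None"
    and \<rho>: "0 < \<rho>"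
    and min: "\<forall>\<^sub>F y in nhds x.
      f x + 1/4 * norm (x - xstar) ^ 4
        + \<rho> * ((\<Sum>i\<in>UNIV. half_sq_dist (J i) (g x $ i)) + (norm (h x))\<^sup>2 / 2)
      \<le> f y + 1/4 * norm (y - xstar) ^ 4
        + \<rho> * ((\<Sum>i\<in>UNIV. half_sq_dist (J i) (g y $ i)) + (norm (h y))\<^sup>2 / 2)"
  defines "\<mu> \<equiv> \<rho> *\<^sub>R h x"
    and "\<omega> \<equiv> \<chi> i. \<rho> *\<^sub>R gap (J i) (g x $ i)"
    and "\<delta> \<equiv> 3 * (norm (x - xstar))\<^sup>2 + (\<Sum>i\<in>IB J g xstar.
      (\<rho> * (norm (gap (J i) (g x $ i)))\<^sup>2 / (g x $ i $ None)\<^sup>2 + 1 / \<rho>) * (norm (g' x))\<^sup>2)"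
  shows "grad (\<lambda>y. lagrangian f g h y \<mu> \<omega>) x = - ((norm (x - xstar))\<^sup>2 *\<^sub>R (x - xstar))" (is ?grad)
    and "\<exists>\<gamma>. \<forall>d. 0 \<le> d \<bullet> (CAKKT2_mat J f g h xstar x \<mu> \<omega> (\<chi> i. \<rho>) (\<lambda>i. \<rho>) \<gamma> \<delta> *v d)" (is ?hess)
proof -
  define y where "y i = gap (J i) (g x $ i)" for i
  define \<epsilon> where "\<epsilon> = 1 / \<rho>\<^sup>2"
  have \<epsilon>: "0 < \<epsilon>" "\<rho> * \<epsilon> = 1 / \<rho>" using \<rho> by (auto simp: \<epsilon>_def power2_eq_square)
  define u where "u d i = g' x d $ i" for d i
  have disj: "I0 g xstar \<inter> IB J g xstar = {}"
    by (auto simp: I0_def IB_def soc_bd_plus_def)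
  have gi: "((\<lambda>y. g y $ i) has_derivative (\<lambda>e. g' y e $ i)) (at y)" for i y
    by (rule bounded_linear.has_derivative[OF bounded_linear_vec_nth g(1)])
  have hi: "((\<lambda>y. h y $ i) has_derivative (\<lambda>e. h' y e $ i)) (at y)" for i y
    by (rule bounded_linear.has_derivative[OF bounded_linear_vec_nth h(1)])
  have Dg: "Dg g i x *v d = u d i" for i d
    using jacobian_works differentiableI[OF gi[of i x]] has_derivative_unique[OF gi[of i x]]
    unfolding Dg_def u_def by metis
  define c where "c d i t = g (x + t *\<^sub>R d) $ i" for d i t
  define c' where "c' d i t = g' (x + t *\<^sub>R d) d $ i" for d i t
  have c: "(c d i has_vector_derivative c' d i t) (at t)"
    "(c' d i has_vector_derivative g'' x d d $ i) (at 0)" for d i t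
    unfolding c_def c'_def
    using bounded_linear.has_vector_derivative[OF bounded_linear_vec_nth
        line_derivatives(1)[of g g' g'', OF g, of x d t]]
      bounded_linear.has_vector_derivative[OF bounded_linear_vec_nth
        line_derivatives(2)[of g g' g'', OF g, of x d]]
    by simp_all
  have c0: "c d i 0 = g x $ i" "c' d i 0 = u d i" for d i by (simp_all add: c_def c'_def u_def)
  have cb: "c d i t \<in> block_space (J i)" for d i t unfolding c_def by (rule blk)
  have "\<exists>C. \<forall>i\<in>IB J g xstar. \<forall>d.
     upper_jet (\<lambda>t. half_sq_dist (J i) (c d i t)) (- (y i \<bullet> u d i))
       (- (y i \<bullet> g'' x d d $ i)
        - (y i $ None / g x $ i $ None) * ((u d i $ None)\<^sup>2 - (norm (tail (u d i)))\<^sup>2)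
        + C i * (norm (tail (g x $ i)) * u d i $ None - tail (g x $ i) \<bullet> tail (u d i))\<^sup>2
        + ((norm (y i))\<^sup>2 / (g x $ i $ None)\<^sup>2 + \<epsilon>) * (norm (u d i))\<^sup>2)"
  proof (rule bchoice, rule ballI)
    fix i assume i: "i \<in> IB J g xstar"
    obtain C where C: "\<And>c c' z. (\<forall>t. c t \<in> block_space (J i)) \<Longrightarrow> c 0 = g x $ i \<Longrightarrow>
     (\<forall>t. (c has_vector_derivative c' t) (at t)) \<Longrightarrow> (c' has_vector_derivative z) (at 0) \<Longrightarrow>
     upper_jet (\<lambda>t. half_sq_dist (J i) (c t)) (- (y i \<bullet> c' 0))
       (- (y i \<bullet> z)
        - (y i $ None / g x $ i $ None) * ((c' 0 $ None)\<^sup>2 - (norm (tail (c' 0)))\<^sup>2)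
        + C * (norm (tail (g x $ i)) * c' 0 $ None - tail (g x $ i) \<bullet> tail (c' 0))\<^sup>2
        + ((norm (y i))\<^sup>2 / (g x $ i $ None)\<^sup>2 + \<epsilon>) * (norm (c' 0))\<^sup>2)"
      using upper_jet_dist_boundary[OF blk IB[OF i] \<epsilon>(1)] unfolding y_def by blast
    show "\<exists>C. \<forall>d. upper_jet (\<lambda>t. half_sq_dist (J i) (c d i t)) (- (y i \<bullet> u d i))
       (- (y i \<bullet> g'' x d d $ i)
        - (y i $ None / g x $ i $ None) * ((u d i $ None)\<^sup>2 - (norm (tail (u d i)))\<^sup>2)
        + C * (norm (tail (g x $ i)) * u d i $ None - tail (g x $ i) \<bullet> tail (u d i))\<^sup>2
        + ((norm (y i))\<^sup>2 / (g x $ i $ None)\<^sup>2 + \<epsilon>) * (norm (u d i))\<^sup>2)"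
      using C[of "c _ i" "c' _ i" "g'' x _ _ $ i"] cb c c0 by (intro exI[of _ C] allI) metis
  qed
  then obtain C where C: "\<And>i d. i \<in> IB J g xstar \<Longrightarrow>
     upper_jet (\<lambda>t. half_sq_dist (J i) (c d i t)) (- (y i \<bullet> u d i))
       (- (y i \<bullet> g'' x d d $ i)
        - (y i $ None / g x $ i $ None) * ((u d i $ None)\<^sup>2 - (norm (tail (u d i)))\<^sup>2)
        + C i * (norm (tail (g x $ i)) * u d i $ None - tail (g x $ i) \<bullet> tail (u d i))\<^sup>2
        + ((norm (y i))\<^sup>2 / (g x $ i $ None)\<^sup>2 + \<epsilon>) * (norm (u d i))\<^sup>2)"
    by blast
  define E where "E d i = - (y i $ None / g x $ i $ None) * ((u d i $ None)\<^sup>2 - (norm (tail (u d i)))\<^sup>2)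
        + C i * (norm (tail (g x $ i)) * u d i $ None - tail (g x $ i) \<bullet> tail (u d i))\<^sup>2
        + ((norm (y i))\<^sup>2 / (g x $ i $ None)\<^sup>2 + \<epsilon>) * (norm (u d i))\<^sup>2" for d i
  define A where "A d i = (if i \<in> IB J g xstar then E d i else if i \<in> I0 g xstar then (norm (u d i))\<^sup>2 else 0)" for d i
  have block: "upper_jet (\<lambda>t. half_sq_dist (J i) (c d i t)) (- (y i \<bullet> u d i)) (- (y i \<bullet> g'' x d d $ i) + A d i)"
    for d i
  proof -
    consider "i \<in> IB J g xstar" | "i \<in> I0 g xstar" "i \<notin> IB J g xstar" | "i \<notin> I0 g xstar" "i \<notin> IB J g xstar"
      by blast
    then show ?thesis
    proof cases
      case 1
      then show ?thesis using C[OF 1, of d] by (simp add: A_def E_def algebra_simps)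
    next
      case 2
      then show ?thesis
        using upper_jet_dist_fixed_point[OF c, of "J i" d i]
        by (simp add: A_def c0 y_def power2_norm_eq_inner)
    next
      case 3
      have "y i = 0" using int[OF 3] blk by (simp add: y_def gap_eq_0_iff soc_iff)
      then show ?thesis
        using 3 upper_jet_dist_interior[OF c(1) cb, of d i] int[OF 3] by (simp add: A_def c0)
    qed
  qed
  define P where "P z = f z + 1/4 * norm (z - xstar) ^ 4
        + \<rho> * ((\<Sum>i\<in>UNIV. half_sq_dist (J i) (g z $ i)) + (norm (h z))\<^sup>2 / 2)" for z
  define a where "a = x - xstar"
  define A1 where "A1 d = f' x d + (norm a)\<^sup>2 * (a \<bullet> d) + \<rho> * ((\<Sum>i\<in>UNIV. - (y i \<bullet> u d i)) + h x \<bullet> h' x d)" for d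
  define A2 where "A2 d = f'' x d d + 3 * (norm a)\<^sup>2 * (norm d)\<^sup>2
      + \<rho> * ((\<Sum>i\<in>UNIV. - (y i \<bullet> g'' x d d $ i) + A d i) + (h' x d \<bullet> h' x d + h x \<bullet> h'' x d d))" for d
  have up: "upper_jet (\<lambda>t. P (x + t *\<^sub>R d)) (A1 d) (A2 d)" for d
  proof -
    have "upper_jet (\<lambda>t. f (x + t *\<^sub>R d)) (f' x d) (f'' x d d)"
      using upper_jet_smooth[of "\<lambda>t. f (x + t *\<^sub>R d)" "\<lambda>t. f' (x + t *\<^sub>R d) d" "f'' x d d"]
        line_derivatives[of f f' f'', OF f, of x d]
      by (simp add: has_real_derivative_iff_has_vector_derivative)
    moreover have "upper_jet (\<lambda>t. 1/4 * norm (x + t *\<^sub>R d - xstar) ^ 4) ((norm a)\<^sup>2 * (a \<bullet> d))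
        (3 * (norm a)\<^sup>2 * (norm d)\<^sup>2)"
      using upper_jet_quartic[of a d] by (simp add: a_def algebra_simps)
    moreover have "upper_jet (\<lambda>t. (norm (h (x + t *\<^sub>R d)))\<^sup>2 / 2) (h x \<bullet> h' x d) (h' x d \<bullet> h' x d + h x \<bullet> h'' x d d)"
      using upper_jet_half_sq_norm[of "\<lambda>t. h (x + t *\<^sub>R d)" "\<lambda>t. h' (x + t *\<^sub>R d) d" "h'' x d d" 0]
        line_derivatives[of h h' h'', OF h, of x d] by simp
    moreover have "upper_jet (\<lambda>t. \<Sum>i\<in>UNIV. half_sq_dist (J i) (g (x + t *\<^sub>R d) $ i))
        (\<Sum>i\<in>UNIV. - (y i \<bullet> u d i)) (\<Sum>i\<in>UNIV. - (y i \<bullet> g'' x d d $ i) + A d i)"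
      using upper_jet_sum[OF finite block[where d = d]] by (simp add: c_def)
    ultimately show ?thesis
      unfolding P_def A1_def A2_def using \<rho> by (intro upper_jet_add upper_jet_cmult) auto
  qed
  have Pmin: "\<forall>\<^sub>F t in nhds 0. P (x + 0 *\<^sub>R d) \<le> P (x + t *\<^sub>R d)" for d
  proof -
    have "((\<lambda>t. x + t *\<^sub>R d) \<longlongrightarrow> x + 0 *\<^sub>R d) (nhds 0)"
      by (intro tendsto_intros) (simp add: filterlim_ident)
    then have "filterlim (\<lambda>t. x + t *\<^sub>R d) (nhds x) (nhds 0)" by simp
    from filterlim_iff[THEN iffD1, OF this, rule_format, OF min]
    show ?thesis by (simp add: P_def)
  qed
  have A1: "A1 d = 0" and A2: "0 \<le> A2 d" for d
    using upper_jet_local_min[OF up Pmin] by blast+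
  note lag = lagrangian_derivatives[of f f' f'' g g' g'' h h' h'', OF f g h, where x = x and \<mu> = \<mu> and \<omega> = \<omega>]
  have om: "\<omega> \<bullet> v = \<rho> * (\<Sum>i\<in>UNIV. y i \<bullet> v $ i)" for v
    by (simp add: \<omega>_def y_def inner_vec_def[of "vec_lambda _"] sum_distrib_left)
  show ?grad
  proof (rule vector_eq_ldot[THEN iffD1], rule allI)
    fix d
    show "d \<bullet> grad (\<lambda>y. lagrangian f g h y \<mu> \<omega>) x = d \<bullet> - ((norm (x - xstar))\<^sup>2 *\<^sub>R (x - xstar))"
      using A1[of d] lag(1)[of d]
      by (simp add: inner_commute A1_def om \<mu>_def u_def sum_negf a_def algebra_simps)
  qed
  show ?hess
  proof (rule exI[of _ "\<lambda>i. \<rho> * C i"], rule allI)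
    fix d
    define R where "R i = ((norm (y i))\<^sup>2 / (g x $ i $ None)\<^sup>2 + \<epsilon>)" for i
    have R0: "0 \<le> R i" for i using \<epsilon> by (simp add: R_def)
    have un: "(norm (u d i))\<^sup>2 \<le> (norm (g' x))\<^sup>2 * (norm d)\<^sup>2" for i
    proof -
      have "norm (u d i) \<le> norm (g' x) * norm d"
        unfolding u_def using order_trans[OF Finite_Cartesian_Product.norm_nth_le norm_blinfun] .
      then show ?thesis by (metis norm_ge_zero power_mono power_mult_distrib)
    qed
    have sumA: "(\<Sum>i\<in>UNIV. A d i) = (\<Sum>i\<in>IB J g xstar. E d i) + (\<Sum>i\<in>I0 g xstar. (norm (u d i))\<^sup>2)"
    proof -
      have "(\<Sum>i\<in>UNIV. A d i) = (\<Sum>i\<in>IB J g xstar \<union> I0 g xstar. A d i)"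
        by (rule sum.mono_neutral_right) (auto simp: A_def)
      also have "\<dots> = (\<Sum>i\<in>IB J g xstar. A d i) + (\<Sum>i\<in>I0 g xstar. A d i)"
        using disj by (intro sum.union_disjoint) auto
      also have "(\<Sum>i\<in>I0 g xstar. A d i) = (\<Sum>i\<in>I0 g xstar. (norm (u d i))\<^sup>2)"
        using disj by (intro sum.cong) (auto simp: A_def)
      finally show ?thesis by (simp add: A_def)
    qed
    have Rle: "\<rho> * (\<Sum>i\<in>IB J g xstar. R i * (norm (u d i))\<^sup>2)
        \<le> (\<Sum>i\<in>IB J g xstar. (\<rho> * (norm (y i))\<^sup>2 / (g x $ i $ None)\<^sup>2 + 1 / \<rho>) * (norm (g' x))\<^sup>2) * (norm d)\<^sup>2"
      unfolding sum_distrib_left sum_distrib_right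
    proof (rule sum_mono)
      fix i
      have "\<rho> * (R i * (norm (u d i))\<^sup>2) \<le> \<rho> * (R i * ((norm (g' x))\<^sup>2 * (norm d)\<^sup>2))"
        using \<rho> R0 un by (intro mult_left_mono) auto
      also have "\<dots> = (\<rho> * (norm (y i))\<^sup>2 / (g x $ i $ None)\<^sup>2 + \<rho> * \<epsilon>) * (norm (g' x))\<^sup>2 * (norm d)\<^sup>2"
        by (simp add: R_def algebra_simps)
      finally show "\<rho> * (R i * (norm (u d i))\<^sup>2)
        \<le> (\<rho> * (norm (y i))\<^sup>2 / (g x $ i $ None)\<^sup>2 + 1 / \<rho>) * (norm (g' x))\<^sup>2 * (norm d)\<^sup>2"
        unfolding \<epsilon>(2) .
    qed
    have "(\<Sum>i\<in>IB J g xstar. E d i) =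
        - (\<Sum>i\<in>IB J g xstar. y i $ None / g x $ i $ None * ((u d i $ None)\<^sup>2 - (norm (tail (u d i)))\<^sup>2))
        + (\<Sum>i\<in>IB J g xstar. C i * (norm (tail (g x $ i)) * u d i $ None - tail (g x $ i) \<bullet> tail (u d i))\<^sup>2)
        + (\<Sum>i\<in>IB J g xstar. R i * (norm (u d i))\<^sup>2)"
      unfolding E_def R_def sum.distrib by (simp add: sum_negf)
    note E = arg_cong[OF this, of "\<lambda>r. \<rho> * r"]
    have \<eta>: "(\<Sum>i\<in>UNIV. (\<chi> i. \<rho>) $ i * (grad (\<lambda>y. h y $ i) x \<bullet> d)\<^sup>2) = \<rho> * (h' x d \<bullet> h' x d)"
      unfolding inner_grad[OF hi]
      by (simp add: inner_vec_def sum_distrib_left power2_eq_square)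
    have \<omega>N: "\<omega> $ i $ None = \<rho> * y i $ None" for i by (simp add: \<omega>_def y_def)
    have "d \<bullet> (CAKKT2_mat J f g h xstar x \<mu> \<omega> (\<chi> i. \<rho>) (\<lambda>i. \<rho>) (\<lambda>i. \<rho> * C i) \<delta> *v d) =
      f'' x d d + \<rho> * (h x \<bullet> h'' x d d) - \<rho> * (\<Sum>i\<in>UNIV. y i \<bullet> g'' x d d $ i)
      - \<rho> * (\<Sum>i\<in>IB J g xstar. y i $ None / g x $ i $ None * ((u d i $ None)\<^sup>2 - (norm (tail (u d i)))\<^sup>2))
      + \<rho> * (h' x d \<bullet> h' x d)
      + \<rho> * (\<Sum>i\<in>IB J g xstar. C i * (norm (tail (g x $ i)) * u d i $ None - tail (g x $ i) \<bullet> tail (u d i))\<^sup>2)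
      + \<rho> * (\<Sum>i\<in>I0 g xstar. (norm (u d i))\<^sup>2) + \<delta> * (norm d)\<^sup>2"
      unfolding CAKKT2_quadratic_form lag(2) \<eta> Dg \<omega>N om
      by (simp add: \<mu>_def sum_distrib_left mult.assoc)
    also have "\<dots> \<ge> A2 d"
      using Rle E unfolding A2_def sum.distrib sumA \<delta>_def a_def y_def[symmetric]
      by (simp add: sum_negf algebra_simps)
    finally show "0 \<le> d \<bullet> (CAKKT2_mat J f g h xstar x \<mu> \<omega> (\<chi> i. \<rho>) (\<lambda>i. \<rho>) (\<lambda>i. \<rho> * C i) \<delta> *v d)"
      using A2[of d] by linarith
  qed
qed

section \<open>CAKKT2 at local minimizers\<close>

lemma jordan_prod_scaleR_right: "jordan_prod w (c *\<^sub>R y) = c *\<^sub>R jordan_prod w y"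
  by (intro block_eqI) (simp_all add: jordan_prod_def scaleR_add_right mult.commute)

theorem mainTheorem2:
  fixes J :: "'r::finite \<Rightarrow> 'm::finite set"
    and f :: "real^'n \<Rightarrow> real"
    and g :: "real^'n \<Rightarrow> (real^('m option))^'r"
    and h :: "real^'n \<Rightarrow> real^'p"
    and xstar :: "real^'n"
  assumes "\<And>x i. g x $ i \<in> block_space (J i)"
    and "twice_cont_diff f" and "twice_cont_diff g" and "twice_cont_diff h"
    and "local_minimizer f (feasible_set J g h) xstar"
    and "bounded_multipliers J f g h xstar \<or> generalized_Lojasiewicz (infeasibility J g h) xstar"
  shows "CAKKT2 J f g h xstar"
proof -
  note blk = assms(1)
  obtain f' f'' where f: "\<And>y. (f has_derivative blinfun_apply (f' y)) (at y)"
      "\<And>y. (f' has_derivative blinfun_apply (f'' y)) (at y)"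
    using assms(2) unfolding twice_cont_diff_def by blast
  obtain g' g'' where g: "\<And>y. (g has_derivative blinfun_apply (g' y)) (at y)"
      "\<And>y. (g' has_derivative blinfun_apply (g'' y)) (at y)"
    using assms(3) unfolding twice_cont_diff_def by blast
  obtain h' h'' where h: "\<And>y. (h has_derivative blinfun_apply (h' y)) (at y)"
      "\<And>y. (h' has_derivative blinfun_apply (h'' y)) (at y)"
    using assms(4) unfolding twice_cont_diff_def by blast
  have cont: "continuous_on S f" "continuous_on S g" "continuous_on S g'" "continuous_on S h" for S
    using f(1) g h(1) by (meson continuous_at_imp_continuous_on has_derivative_continuous)+
  obtain r where feas: "xstar \<in> feasible_set J g h" and r: "0 < r"
    "\<And>y. y \<in> feasible_set J g h \<Longrightarrow> dist y xstar < r \<Longrightarrow> f xstar \<le> f y"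
    using assms(5) unfolding local_minimizer_def by blast
  define G where "G y = f y + 1/4 * norm (y - xstar) ^ 4" for y
  define V where "V y = (\<Sum>i\<in>UNIV. half_sq_dist (J i) (g y $ i)) + (norm (h y))\<^sup>2 / 2" for y
  define \<rho> where "\<rho> k = real (Suc k)" for k
  have \<rho>: "filterlim \<rho> at_top sequentially" "0 < \<rho> k" for k
    unfolding \<rho>_def using filterlim_compose[OF filterlim_real_sequentially filterlim_Suc] by auto
  have V: "0 \<le> V y" for y
    unfolding V_def by (intro add_nonneg_nonneg sum_nonneg half_sq_dist_nonneg) auto
  have V0: "V y = 0 \<longleftrightarrow> y \<in> feasible_set J g h" for y
    unfolding V_def feasible_set_def
    by (subst add_nonneg_eq_0_iff)
      (auto simp: sum_nonneg_eq_0_iff half_sq_dist_nonneg half_sq_dist_eq_0_iff intro!: sum_nonneg)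
  have contG: "continuous_on S G" for S unfolding G_def by (intro continuous_intros cont)
  have contV: "continuous_on S V" for S
    unfolding V_def
    by (intro continuous_intros cont continuous_on_compose2[OF continuous_on_half_sq_dist[of UNIV]]) auto
  have strict: "y = xstar" if y: "y \<in> cball xstar (r / 2)" "V y = 0" "G y \<le> G xstar" for y
  proof -
    have "f xstar \<le> f y" using y V0 r by (intro r(2)) (auto simp: dist_commute)
    moreover have "f y + 1/4 * norm (y - xstar) ^ 4 \<le> f xstar" using y(3) by (simp add: G_def)
    ultimately have "norm (y - xstar) ^ 4 \<le> 0" by linarith
    then have "norm (y - xstar) = 0" by (simp only: power_le_zero_eq) auto
    then show ?thesis by simp
  qed
  have "xstar \<in> cball xstar (r / 2)" "V xstar = 0" using r(1) feas V0 by auto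
  then obtain x where xmin: "\<forall>k. \<forall>y\<in>cball xstar (r / 2). G (x k) + \<rho> k * V (x k) \<le> G y + \<rho> k * V y"
    and xlim: "x \<longlonglongrightarrow> xstar" and \<rho>V: "(\<lambda>k. \<rho> k * V (x k)) \<longlonglongrightarrow> 0"
    by (rule penalty_minimizers[OF compact_cball contG contV V _ _ strict \<rho>])
  have lims: "(\<lambda>k. g (x k)) \<longlonglongrightarrow> g xstar" "(\<lambda>k. norm (g' (x k))) \<longlonglongrightarrow> norm (g' xstar)"
    using continuous_on_tendsto_compose[OF cont(2)[of UNIV] xlim]
      tendsto_norm[OF continuous_on_tendsto_compose[OF cont(3)[of UNIV] xlim]] by auto
  have gN: "(\<lambda>k. g (x k) $ i $ None) \<longlonglongrightarrow> g xstar $ i $ None" for i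
    by (intro tendsto_vec_nth lims)
  define y where "y k i = gap (J i) (g (x k) $ i)" for k i
  have \<rho>y: "(\<lambda>k. \<rho> k * (norm (y k i))\<^sup>2) \<longlonglongrightarrow> 0" for i
  proof (rule real_tendsto_sandwich[OF _ _ tendsto_const tendsto_mult_right_zero[OF \<rho>V, of 2]])
    have "(norm (y k i))\<^sup>2 / 2 \<le> V (x k)" for k
    proof -
      have "half_sq_dist (J i) (g (x k) $ i) \<le> (\<Sum>i\<in>UNIV. half_sq_dist (J i) (g (x k) $ i))"
        by (rule member_le_sum) (auto simp: half_sq_dist_nonneg)
      then show ?thesis unfolding V_def y_def half_sq_dist_def[symmetric] by (simp add: add_increasing2)
    qed
    then have "\<rho> k * (norm (y k i))\<^sup>2 \<le> 2 * (\<rho> k * V (x k))" for k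
      using mult_left_mono[OF _ less_imp_le[OF \<rho>(2)], of "(norm (y k i))\<^sup>2 / 2" "V (x k)" k] by simp
    then show "\<forall>\<^sub>F k in sequentially. \<rho> k * (norm (y k i))\<^sup>2 \<le> 2 * (\<rho> k * V (x k))" by simp
    show "\<forall>\<^sub>F k in sequentially. 0 \<le> \<rho> k * (norm (y k i))\<^sup>2"
      using \<rho>(2) by (simp add: less_imp_le)
  qed
  have \<rho>h: "(\<lambda>k. \<rho> k * (h (x k) $ i)\<^sup>2) \<longlonglongrightarrow> 0" for i
  proof (rule real_tendsto_sandwich[OF _ _ tendsto_const tendsto_mult_right_zero[OF \<rho>V, of 2]])
    have "(h (x k) $ i)\<^sup>2 / 2 \<le> V (x k)" for k
    proof -
      have "(h (x k) $ i)\<^sup>2 \<le> (norm (h (x k)))\<^sup>2"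
        using component_le_norm_cart[of "h (x k)" i] by (metis abs_ge_zero power2_abs power_mono)
      then show ?thesis unfolding V_def
        using sum_nonneg[of UNIV "\<lambda>i. half_sq_dist (J i) (g (x k) $ i)"] half_sq_dist_nonneg by fastforce
    qed
    then have "\<rho> k * (h (x k) $ i)\<^sup>2 \<le> 2 * (\<rho> k * V (x k))" for k
      using mult_left_mono[OF _ less_imp_le[OF \<rho>(2)], of "(h (x k) $ i)\<^sup>2 / 2" "V (x k)" k] by simp
    then show "\<forall>\<^sub>F k in sequentially. \<rho> k * (h (x k) $ i)\<^sup>2 \<le> 2 * (\<rho> k * V (x k))" by simp
    show "\<forall>\<^sub>F k in sequentially. 0 \<le> \<rho> k * (h (x k) $ i)\<^sup>2"
      using \<rho>(2) by (simp add: less_imp_le)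
  qed
  define \<mu> where "\<mu> k = \<rho> k *\<^sub>R h (x k)" for k
  define \<omega> where "\<omega> k = (\<chi> i. \<rho> k *\<^sub>R gap (J i) (g (x k) $ i))" for k
  define \<delta> where "\<delta> k = 3 * (norm (x k - xstar))\<^sup>2 + (\<Sum>i\<in>IB J g xstar.
      (\<rho> k * (norm (gap (J i) (g (x k) $ i)))\<^sup>2 / (g (x k) $ i $ None)\<^sup>2 + 1 / \<rho> k)
        * (norm (g' (x k)))\<^sup>2)" for k
  have IBpos: "0 < g xstar $ i $ None" if "i \<in> IB J g xstar" for i
    using that by (auto simp: IB_def soc_bd_plus_def)
  have IBev: "\<forall>\<^sub>F k in sequentially. \<forall>i\<in>IB J g xstar. 0 < g (x k) $ i $ None"
    using order_tendstoD(1)[OF gN IBpos] by (intro eventually_ball_finite) auto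
  have intev: "\<forall>\<^sub>F k in sequentially. \<forall>i\<in>- (I0 g xstar \<union> IB J g xstar).
      norm (tail (g (x k) $ i)) < g (x k) $ i $ None"
  proof (intro eventually_ball_finite ballI)
    fix i assume i: "i \<in> - (I0 g xstar \<union> IB J g xstar)"
    have "g xstar $ i \<in> soc (J i)" using feas by (auto simp: feasible_set_def)
    moreover have "norm (tail (g xstar $ i)) \<noteq> g xstar $ i $ None"
    proof
      assume e: "norm (tail (g xstar $ i)) = g xstar $ i $ None"
      then have "norm (tail (g xstar $ i)) = 0"
        using i blk[of xstar i] by (auto simp: IB_def soc_bd_plus_def)
      then have "g xstar $ i = 0" using e by (intro block_eqI) auto
      then show False using i by (simp add: I0_def)
    qed
    ultimately have "0 < g xstar $ i $ None - norm (tail (g xstar $ i))" by (simp add: soc_iff)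
    moreover have "(\<lambda>k. g (x k) $ i $ None - norm (tail (g (x k) $ i)))
        \<longlonglongrightarrow> g xstar $ i $ None - norm (tail (g xstar $ i))"
      by (intro tendsto_intros lims bounded_linear.tendsto[OF bounded_linear_tail])
    ultimately have "\<forall>\<^sub>F k in sequentially. 0 < g (x k) $ i $ None - norm (tail (g (x k) $ i))"
      by (rule order_tendstoD(1)[rotated])
    then show "\<forall>\<^sub>F k in sequentially. norm (tail (g (x k) $ i)) < g (x k) $ i $ None"
      by (rule eventually_mono) simp
  qed simp
  have ballev: "\<forall>\<^sub>F k in sequentially. x k \<in> ball xstar (r / 2)"
    using topological_tendstoD[OF xlim open_ball, of xstar "r / 2"] r(1) by simp
  define good where "good k \<longleftrightarrow> (\<forall>i\<in>IB J g xstar. 0 < g (x k) $ i $ None)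
     \<and> (\<forall>i\<in>- (I0 g xstar \<union> IB J g xstar). norm (tail (g (x k) $ i)) < g (x k) $ i $ None)
     \<and> x k \<in> ball xstar (r / 2)" for k
  have goodev: "\<forall>\<^sub>F k in sequentially. good k"
    unfolding good_def using IBev intev ballev by (intro eventually_conj)
  have st: "grad (\<lambda>y. lagrangian f g h y (\<mu> k) (\<omega> k)) (x k) = - ((norm (x k - xstar))\<^sup>2 *\<^sub>R (x k - xstar))"
      "\<exists>\<gamma>. \<forall>d. 0 \<le> d \<bullet> (CAKKT2_mat J f g h xstar (x k) (\<mu> k) (\<omega> k) (\<chi> i. \<rho> k) (\<lambda>i. \<rho> k) \<gamma> (\<delta> k) *v d)"
    if k: "good k" for k
  proof -
    have min: "\<forall>\<^sub>F y in nhds (x k).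
      f (x k) + 1/4 * norm (x k - xstar) ^ 4
        + \<rho> k * ((\<Sum>i\<in>UNIV. half_sq_dist (J i) (g (x k) $ i)) + (norm (h (x k)))\<^sup>2 / 2)
      \<le> f y + 1/4 * norm (y - xstar) ^ 4
        + \<rho> k * ((\<Sum>i\<in>UNIV. half_sq_dist (J i) (g y $ i)) + (norm (h y))\<^sup>2 / 2)"
    proof -
      have "\<forall>\<^sub>F y in nhds (x k). y \<in> ball xstar (r / 2)"
        using k by (intro eventually_nhds_in_open) (auto simp: good_def)
      then show ?thesis
        by (rule eventually_mono) (use xmin in \<open>auto simp: G_def V_def\<close>)
    qed
    note * = penalty_stationarity[of f f' f'' g g' g'' h h' h'' J xstar "x k" "\<rho> k", OF f g h blk _ _ \<rho>(2) min,
        folded \<mu>_def \<omega>_def \<delta>_def]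
    show "grad (\<lambda>y. lagrangian f g h y (\<mu> k) (\<omega> k)) (x k) = - ((norm (x k - xstar))\<^sup>2 *\<^sub>R (x k - xstar))"
      by (rule *(1)) (use k in \<open>auto simp: good_def\<close>)
    show "\<exists>\<gamma>. \<forall>d. 0 \<le> d \<bullet> (CAKKT2_mat J f g h xstar (x k) (\<mu> k) (\<omega> k) (\<chi> i. \<rho> k) (\<lambda>i. \<rho> k) \<gamma> (\<delta> k) *v d)"
      by (rule *(2)) (use k in \<open>auto simp: good_def\<close>)
  qed
  obtain \<gamma> where \<gamma>: "\<And>k d. good k \<Longrightarrow>
      0 \<le> d \<bullet> (CAKKT2_mat J f g h xstar (x k) (\<mu> k) (\<omega> k) (\<chi> i. \<rho> k) (\<lambda>i. \<rho> k) (\<gamma> k) (\<delta> k) *v d)"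
    using st(2) by metis
  have seq: "CAKKT_seq J f g h xstar x \<mu> \<omega>"
    unfolding CAKKT_seq_def
  proof (intro conjI allI feas xlim)
    show "\<omega> k \<in> soc_prod J" for k
      using \<rho>(2)[of k] gap_in_soc[OF blk]
      by (auto simp: soc_prod_def \<omega>_def intro: scaleR_in_soc)
    have "(\<lambda>k. - ((norm (x k - xstar))\<^sup>2 *\<^sub>R (x k - xstar)))
        \<longlonglongrightarrow> - ((norm (xstar - xstar))\<^sup>2 *\<^sub>R (xstar - xstar))"
      by (intro tendsto_intros xlim)
    then have "(\<lambda>k. - ((norm (x k - xstar))\<^sup>2 *\<^sub>R (x k - xstar))) \<longlonglongrightarrow> 0" by simp
    moreover have "\<forall>\<^sub>F k in sequentially. grad (\<lambda>y. lagrangian f g h y (\<mu> k) (\<omega> k)) (x k)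
        = - ((norm (x k - xstar))\<^sup>2 *\<^sub>R (x k - xstar))"
      using goodev by (rule eventually_mono) (rule st(1))
    ultimately show "(\<lambda>k. grad (\<lambda>y. lagrangian f g h y (\<mu> k) (\<omega> k)) (x k)) \<longlonglongrightarrow> 0"
      by (simp only: tendsto_cong)
    show "(\<lambda>k. jordan_prod (g (x k) $ i) (\<omega> k $ i)) \<longlonglongrightarrow> 0" for i
    proof (rule Lim_null_comparison[OF _ tendsto_mult_right_zero[OF \<rho>y[of i], of 2]])
      have "norm (jordan_prod (g (x k) $ i) (\<omega> k $ i)) \<le> 2 * (\<rho> k * (norm (y k i))\<^sup>2)" for k
        using mult_left_mono[OF norm_jordan_gap[OF blk[of "x k" i]] less_imp_le[OF \<rho>(2)], of k] \<rho>(2)[of k]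
        by (simp add: \<omega>_def y_def jordan_prod_scaleR_right algebra_simps)
      then show "\<forall>\<^sub>F k in sequentially. norm (jordan_prod (g (x k) $ i) (\<omega> k $ i)) \<le> 2 * (\<rho> k * (norm (y k i))\<^sup>2)"
        by simp
    qed
    show "(\<lambda>k. h (x k) $ i * \<mu> k $ i) \<longlonglongrightarrow> 0" for i
      using \<rho>h[of i] by (simp add: \<mu>_def power2_eq_square algebra_simps)
  qed
  have \<delta>0: "0 \<le> \<delta> k" for k
    unfolding \<delta>_def using \<rho>(2)[of k] by (intro add_nonneg_nonneg sum_nonneg mult_nonneg_nonneg) auto
  have \<delta>lim: "\<delta> \<longlonglongrightarrow> 0"
  proof -
    have "(\<lambda>k. 1 / \<rho> k) \<longlonglongrightarrow> 0"
      by (rule real_tendsto_divide_at_top[OF tendsto_const \<rho>(1)])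
    then have "(\<lambda>k. 3 * (norm (x k - xstar))\<^sup>2 + (\<Sum>i\<in>IB J g xstar.
        (\<rho> k * (norm (y k i))\<^sup>2 / (g (x k) $ i $ None)\<^sup>2 + 1 / \<rho> k) * (norm (g' (x k)))\<^sup>2))
      \<longlonglongrightarrow> 3 * (norm (xstar - xstar))\<^sup>2 + (\<Sum>i\<in>IB J g xstar.
        (0 / (g xstar $ i $ None)\<^sup>2 + 0) * (norm (g' xstar))\<^sup>2)"
      using IBpos by (intro tendsto_intros xlim lims \<rho>y gN) fastforce+
    then show ?thesis unfolding \<delta>_def y_def by simp
  qed
  show ?thesis
    unfolding CAKKT2_def
    by (intro exI conjI allI, rule seq, rule \<delta>0, rule \<delta>lim, rule eventually_mono[OF goodev])
      (use \<gamma> in auto)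
qed

end
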